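(* Let $j: R \to S$ be a ring homomorphism such that both $R_{\mathrm{red}}$ and $S_{\mathrm{red}}$ are $F$-finite. Let $M$ be an $R$-module, regard $\operatorname{Hom}_R(S,M)$ as an $S$-module, and let $\epsilon: \operatorname{Hom}_R(S,M) \to M$ be the evaluation map $\epsilon(g) = g(1)$. Then $\epsilon$ restricts to tight interiors, i.e. $\epsilon\big(\operatorname{Hom}_R(S,M)_{*S}\big) \subseteq M_{*R}$.
   Context: Rings are commutative Noetherian of prime characteristic $p>0$. A ring is $F$-finite if its Frobenius endomorphism is a finite map. $R_{\mathrm{red}}$ is $R$ modulo its nilradical. $R^\circ$ is the set of elements of $R$ not contained in any minimal prime of $R$. For an $R$-module $M$ and an integer $e\ge 0$, ${}^eM=\{{}^ex : x\in M\}$ is $M$ as an abelian group, with $R$-module structure $r\cdot{}^ex={}^e(r^{p^e}x)$ (so $\operatorname{Hom}_R({}^eR,M)$ uses this structure). For $c\in R^\circ$ and $e_0\ge 0$ put $$M_*[c,p^{e_0}]=\sum_{e\ge e_0}\operatorname{im}\big(\operatorname{Hom}_R({}^eR,M)\to M,\ g\mapsto g({}^ec)\big).$$ The tight interior of $M$ (over $R$) is $M_{*R}=M_*=\bigcap_{c\in R^\circ}\bigcap_{e_0\ge 0}M_*[c,p^{e_0}]$. For an $S$-module $N$, $N_{*S}$ denotes the tight interior of $N$ computed over $S$. The $S$-module structure on $\operatorname{Hom}_R(S,M)$ is $(sg)(t)=g(st)$. *)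

theory Defs
  imports "HOL-Algebra.Ring_Divisibility" "HOL-Algebra.Module" "HOL-Computational_Algebra.Primes"
begin

definition has_char :: "('a, 'r) ring_scheme \<Rightarrow> nat \<Rightarrow> bool" where
  "has_char R p \<longleftrightarrow> (\<forall>n::nat. add_pow R n \<one>\<^bsub>R\<^esub> = \<zero>\<^bsub>R\<^esub> \<longleftrightarrow> p dvd n)"

definition nilradical :: "('a, 'r) ring_scheme \<Rightarrow> 'a set" where
  "nilradical R = {x \<in> carrier R. \<exists>n::nat. x [^]\<^bsub>R\<^esub> n = \<zero>\<^bsub>R\<^esub>}"

definition reduced_ring :: "('a, 'r) ring_scheme \<Rightarrow> 'a set ring" where
  "reduced_ring R = R Quot nilradical R"

definition finite_ring_map ::
  "('a, 'r) ring_scheme \<Rightarrow> ('b, 's) ring_scheme \<Rightarrow> ('a \<Rightarrow> 'b) \<Rightarrow> bool" where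
  "finite_ring_map A B f \<longleftrightarrow> f \<in> ring_hom A B \<and>
     (\<exists>G. finite G \<and> G \<subseteq> carrier B \<and>
       (\<forall>b \<in> carrier B. \<exists>a \<in> G \<rightarrow> carrier A. b = (\<Oplus>\<^bsub>B\<^esub>x\<in>G. f (a x) \<otimes>\<^bsub>B\<^esub> x)))"

definition F_finite :: "nat \<Rightarrow> ('a, 'r) ring_scheme \<Rightarrow> bool" where
  "F_finite p R \<longleftrightarrow> finite_ring_map R R (\<lambda>x. x [^]\<^bsub>R\<^esub> p)"

definition minimal_prime :: "'a set \<Rightarrow> ('a, 'r) ring_scheme \<Rightarrow> bool" where
  "minimal_prime P R \<longleftrightarrow> primeideal P R \<and> (\<forall>Q. primeideal Q R \<and> Q \<subseteq> P \<longrightarrow> Q = P)"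

definition ring_circ :: "('a, 'r) ring_scheme \<Rightarrow> 'a set" where
  "ring_circ R = {c \<in> carrier R. \<forall>P. minimal_prime P R \<longrightarrow> c \<notin> P}"

text \<open>
  The library's module records extend ring records; the module axioms do not involve
  the fields \<open>mult\<close> and \<open>one\<close>, so their values in the modules built below are immaterial.
\<close>

definition regular_module :: "('a, 'r) ring_scheme \<Rightarrow> ('a, 'a) module" where
  "regular_module R =
     \<lparr>carrier = carrier R, monoid.mult = monoid.mult R, one = one R, zero = zero R, add = add R,
      smult = monoid.mult R\<rparr>"

definition restrict_scalars ::
  "('a \<Rightarrow> 'b) \<Rightarrow> ('b, 'm, 'k) module_scheme \<Rightarrow> ('a, 'm) module" where
  "restrict_scalars j N =
     \<lparr>carrier = carrier N, monoid.mult = monoid.mult N, one = one N, zero = zero N, add = add N,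
      smult = (\<lambda>r x. j r \<odot>\<^bsub>N\<^esub> x)\<rparr>"

text \<open>
  \<open>frob_module p e R M\<close> is ${}^eM$: the symbols ${}^ex$ are identified with the elements
  \<open>x\<close> themselves, so only the scalar multiplication changes.
\<close>

definition frob_module ::
  "nat \<Rightarrow> nat \<Rightarrow> ('a, 'r) ring_scheme \<Rightarrow> ('a, 'm, 'k) module_scheme \<Rightarrow> ('a, 'm) module" where
  "frob_module p e R M = restrict_scalars (\<lambda>r. r [^]\<^bsub>R\<^esub> (p ^ e)) M"

text \<open>
  Homomorphisms are extensional functions, so that equality of homomorphisms is
  equality on the carrier.
\<close>

definition module_hom ::
  "('a, 'r) ring_scheme \<Rightarrow> ('a, 'm, 'k) module_scheme \<Rightarrow> ('a, 'n, 'l) module_scheme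
     \<Rightarrow> ('m \<Rightarrow> 'n) set" where
  "module_hom R M N =
     {g \<in> carrier M \<rightarrow>\<^sub>E carrier N.
        (\<forall>x \<in> carrier M. \<forall>y \<in> carrier M. g (x \<oplus>\<^bsub>M\<^esub> y) = g x \<oplus>\<^bsub>N\<^esub> g y) \<and>
        (\<forall>r \<in> carrier R. \<forall>x \<in> carrier M. g (r \<odot>\<^bsub>M\<^esub> x) = r \<odot>\<^bsub>N\<^esub> g x)}"

text \<open>The \<open>S\<close>-module $\mathrm{Hom}_R(S,M)$, where \<open>S\<close> is an \<open>R\<close>-module through \<open>j\<close>.\<close>

definition Hom_module ::
  "('a, 'r) ring_scheme \<Rightarrow> ('b, 's) ring_scheme \<Rightarrow> ('a \<Rightarrow> 'b) \<Rightarrow> ('a, 'm, 'k) module_scheme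
     \<Rightarrow> ('b, 'b \<Rightarrow> 'm) module" where
  "Hom_module R S j M =
     \<lparr>carrier = module_hom R (restrict_scalars j (regular_module S)) M,
      monoid.mult = undefined, one = undefined,
      zero = (\<lambda>t \<in> carrier S. \<zero>\<^bsub>M\<^esub>),
      add = (\<lambda>g h. \<lambda>t \<in> carrier S. g t \<oplus>\<^bsub>M\<^esub> h t),
      smult = (\<lambda>s g. \<lambda>t \<in> carrier S. g (s \<otimes>\<^bsub>S\<^esub> t))\<rparr>"

text \<open>The sum of a possibly infinite family of submodules: all finite sums of their elements.\<close>

definition submodule_sum ::
  "('a, 'm, 'k) module_scheme \<Rightarrow> 'i set \<Rightarrow> ('i \<Rightarrow> 'm set) \<Rightarrow> 'm set" where
  "submodule_sum M I N =
     {x. \<exists>E y. finite E \<and> E \<subseteq> I \<and> (\<forall>i\<in>E. y i \<in> N i) \<and> x = (\<Oplus>\<^bsub>M\<^esub>i\<in>E. y i)}"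

text \<open>\<open>interior_approx p R M c e\<^sub>0\<close> is $M_*[c,p^{e_0}]$.\<close>

definition interior_approx ::
  "nat \<Rightarrow> ('a, 'r) ring_scheme \<Rightarrow> ('a, 'm, 'k) module_scheme \<Rightarrow> 'a \<Rightarrow> nat \<Rightarrow> 'm set" where
  "interior_approx p R M c e\<^sub>0 =
     submodule_sum M {e\<^sub>0..} (\<lambda>e. (\<lambda>g. g c) ` module_hom R (frob_module p e R (regular_module R)) M)"

definition tight_interior ::
  "nat \<Rightarrow> ('a, 'r) ring_scheme \<Rightarrow> ('a, 'm, 'k) module_scheme \<Rightarrow> 'm set" where
  "tight_interior p R M = (\<Inter>c \<in> ring_circ R. \<Inter>e\<^sub>0. interior_approx p R M c e\<^sub>0)"

end

theory Submission
  imports Defs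
begin

text \<open>
  If \<open>c \<in> R\<^sup>\<circ>\<close> happens to satisfy \<open>j c \<in> S\<^sup>\<circ>\<close>, then the inclusion of tight interiors is seen at
  once: an element \<open>g\<close> of the tight interior of \<open>Hom\<^sub>R(S, M)\<close> is a sum of values \<open>h\<^sub>i (j c)\<close> with
  \<open>h\<^sub>i : \<^sup>iS \<rightarrow> Hom\<^sub>R(S, M)\<close>, and \<open>x \<mapsto> h\<^sub>i (j x) 1\<close> is an \<open>R\<close>-linear map \<open>\<^sup>iR \<rightarrow> M\<close> with value
  \<open>h\<^sub>i (j c) 1\<close> at \<open>c\<close>.  In general \<open>j c\<close> may lie in minimal primes of \<open>S\<close>, but nothing forces
  the use of \<open>j\<close> itself.  Any \<open>R\<close>-linear map \<open>\<theta> : \<^sup>eR \<rightarrow> \<^sup>kS\<close> with \<open>\<theta> c \<in> S\<^sup>\<circ>\<close> serves as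
  well: for \<open>i \<ge> k\<close> the map \<open>x \<mapsto> h\<^sub>i (\<theta> x) 1\<close> is \<open>R\<close>-linear on \<open>\<^sup>e\<^sup>+\<^sup>i\<^sup>-\<^sup>kR\<close>
  (\<open>semilinear_comp_eval\<close>), and the shift of exponents is harmless because the tight interior
  lets \<open>i\<close> be as large as desired.

  So the theorem reduces to the existence of \<open>\<theta>\<close> (\<open>exists_semilinear_value_in_circ\<close>).  Let \<open>Q\<close> be
  a minimal prime of \<open>S\<close>, let \<open>P\<close> be its preimage in \<open>R\<close>, and let \<open>P\<^sub>0 \<subseteq> P\<close> be a minimal
  prime, so that \<open>c \<notin> P\<^sub>0\<close>.  A Krull intersection argument shows that, locally at \<open>P\<close> and modulo
  \<open>P\<^sub>0\<close>, the element \<open>c\<close> is not in the ideal generated by the \<open>p\<^sup>e\<close>-th powers of \<open>P\<close> for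
  large \<open>e\<close> (\<open>obtain_ideal_avoiding_element\<close>).  Since \<open>\<^sup>eR\<close> is finite up to nilpotents, linear
  algebra over \<open>R / P\<close> then provides an \<open>R\<close>-linear map \<open>\<^sup>eR \<rightarrow> R / P\<close> that does not kill \<open>c\<close>
  (\<open>exists_frob_functional\<close>).  Its composite with \<open>R / P \<rightarrow> S / Q\<close> is lifted to \<open>S\<close>: a factor
  from the other minimal primes makes it well defined modulo nilpotents, and a high Frobenius power
  kills these (\<open>exists_semilinear_value_outside\<close>).  Finally, for fixed \<open>e\<close> and \<open>k\<close> the values
  \<open>\<theta> c\<close> form an ideal of \<open>S\<close>; as it is contained in no minimal prime, prime avoidance gives a
  single \<open>\<theta>\<close> with \<open>\<theta> c \<in> S\<^sup>\<circ>\<close>.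
\<close>

section \<open>Frobenius powers in prime characteristic\<close>

lemma (in cring) binomial_theorem:
  assumes x: "x \<in> carrier R" and y: "y \<in> carrier R"
  shows "(x \<oplus> y) [^] (n::nat) = (\<Oplus>k\<in>{..n}. [(n choose k)] \<cdot> (x [^] k \<otimes> y [^] (n - k)))"
proof (induction n)
  case 0
  then show ?case using x y by (simp add: add.nat_pow_Suc)
next
  case (Suc n)
  define t where "t k = x [^] k \<otimes> y [^] (n - k)" for k
  have t: "t k \<in> carrier R" for k using x y by (simp add: t_def)
  have X: "(\<Oplus>k\<in>{..n}. [(n choose k)] \<cdot> t k) \<otimes> x
      = (\<Oplus>k\<in>{..n}. [(n choose k)] \<cdot> (x [^] Suc k \<otimes> y [^] (n - k)))"
    using x y t
    by (subst finsum_ldistr) (auto intro!: finsum_cong' simp: add_pow_ldistr add_pow_rdistr t_def m_ac)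
  have "(\<Oplus>k\<in>{..n}. [(n choose k)] \<cdot> t k) \<otimes> y
      = (\<Oplus>k\<in>{..n}. [(n choose k)] \<cdot> (x [^] k \<otimes> y [^] (Suc n - k)))"
    using x y t
    by (subst finsum_ldistr)
       (auto intro!: finsum_cong' simp: add_pow_ldistr t_def m_assoc Suc_diff_le)
  also have "\<dots> = (\<Oplus>k\<in>{..Suc n}. [(n choose k)] \<cdot> (x [^] k \<otimes> y [^] (Suc n - k)))"
    using x y by (subst finsum_Suc) (auto simp: binomial_eq_0 Pi_def)
  also have "\<dots> = (\<Oplus>k\<in>{..n}. [(n choose Suc k)] \<cdot> (x [^] Suc k \<otimes> y [^] (n - k))) \<oplus> y [^] Suc n"
    using x y by (subst finsum_Suc2) (auto simp: Pi_def simp del: binomial_Suc_Suc nat_pow_Suc)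
  finally have Y: "(\<Oplus>k\<in>{..n}. [(n choose k)] \<cdot> t k) \<otimes> y = \<dots>" .
  have "(x \<oplus> y) [^] Suc n = (\<Oplus>k\<in>{..n}. [(n choose k)] \<cdot> t k) \<otimes> x \<oplus> (\<Oplus>k\<in>{..n}. [(n choose k)] \<cdot> t k) \<otimes> y"
    using Suc x y t by (simp add: t_def r_distr)
  also have "\<dots> = (\<Oplus>k\<in>{..n}. [(n choose k)] \<cdot> (x [^] Suc k \<otimes> y [^] (n - k)) \<oplus> [(n choose Suc k)] \<cdot> (x [^] Suc k \<otimes> y [^] (n - k))) \<oplus> y [^] Suc n"
    unfolding X Y using x y by (subst finsum_addf) (auto simp: a_assoc simp del: nat_pow_Suc)
  also have "\<dots> = (\<Oplus>k\<in>{..n}. [(Suc n choose Suc k)] \<cdot> (x [^] Suc k \<otimes> y [^] (n - k))) \<oplus> y [^] Suc n"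
    using x y by (auto intro!: arg_cong2[where f="(\<oplus>)"] finsum_cong' simp: add.nat_pow_mult simp del: nat_pow_Suc)
  also have "\<dots> = (\<Oplus>k\<in>{..Suc n}. [(Suc n choose k)] \<cdot> (x [^] k \<otimes> y [^] (Suc n - k)))"
    using x y by (subst finsum_Suc2) (auto simp: Pi_def simp del: binomial_Suc_Suc nat_pow_Suc)
  finally show ?case .
qed

locale prime_char_ring = cring R for R (structure) +
  fixes p :: nat
  assumes prime_p: "prime p" and char_p: "has_char R p"
begin

lemma add_pow_dvd_zero:
  assumes "p dvd n" "x \<in> carrier R"
  shows "[n] \<cdot> x = \<zero>"
proof -
  have "[n] \<cdot> x = ([n] \<cdot> \<one>) \<otimes> x"
    using assms by (simp add: add_pow_ldistr)
  moreover have "[n] \<cdot> \<one> = \<zero>"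
    using char_p assms(1) unfolding has_char_def by blast
  ultimately show ?thesis using assms(2) by simp
qed

text \<open>
  The inner terms of the binomial expansion vanish because their coefficients are
  divisible by \<open>p\<close>.
\<close>

lemma frobenius_add:
  assumes x: "x \<in> carrier R" and y: "y \<in> carrier R"
  shows "(x \<oplus> y) [^] p = x [^] p \<oplus> y [^] p"
proof -
  obtain m where m: "p = Suc (Suc m)"
    using prime_p prime_ge_2_nat by (metis add_2_eq_Suc le_Suc_ex)
  have inner: "[(p choose Suc k)] \<cdot> (x [^] Suc k \<otimes> y [^] (p - Suc k)) = \<zero>" if "k \<le> m" for k
    using that x y m prime_p by (intro add_pow_dvd_zero dvd_choose_prime) auto
  have "(x \<oplus> y) [^] p = (\<Oplus>k\<in>{..Suc (Suc m)}. [(p choose k)] \<cdot> (x [^] k \<otimes> y [^] (p - k)))"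
    using x y binomial_theorem[of x y p] by (simp add: m)
  also have "\<dots> = x [^] p \<oplus> ((\<Oplus>k\<in>{..m}. [(p choose Suc k)] \<cdot> (x [^] Suc k \<otimes> y [^] (p - Suc k))) \<oplus> y [^] p)"
    using x y
    by (subst finsum_Suc, force, subst finsum_Suc2)
       (auto simp: m Pi_def simp del: binomial_Suc_Suc nat_pow_Suc)
  also have "(\<Oplus>k\<in>{..m}. [(p choose Suc k)] \<cdot> (x [^] Suc k \<otimes> y [^] (p - Suc k))) = \<zero>"
    using inner finsum_cong'[of "{..m}" "{..m}" "\<lambda>_. \<zero>" "\<lambda>k. [(p choose Suc k)] \<cdot> (x [^] Suc k \<otimes> y [^] (p - Suc k))"]
    by (simp add: finsum_zero)
  finally show ?thesis using x y by simp
qed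

lemma pow_p_Suc: "x \<in> carrier R \<Longrightarrow> x [^] (p ^ Suc e) = (x [^] (p ^ e)) [^] p"
  by (simp add: nat_pow_pow mult.commute)

lemma pow_p_add: "x \<in> carrier R \<Longrightarrow> x [^] (p ^ (d + e)) = (x [^] (p ^ d)) [^] (p ^ e)"
  by (simp add: nat_pow_pow power_add)

lemma frobenius_pow_add:
  assumes "x \<in> carrier R" "y \<in> carrier R"
  shows "(x \<oplus> y) [^] (p ^ e) = x [^] (p ^ e) \<oplus> y [^] (p ^ e)"
proof (induction e)
  case (Suc e)
  then show ?case using assms by (simp only: pow_p_Suc frobenius_add a_closed nat_pow_closed)
qed (use assms in simp)

lemma pow_p_pos: "0 < p ^ e"
  using prime_p by (simp add: prime_gt_0_nat)

lemma zero_pow_p: "\<zero> [^] (p ^ e) = \<zero>"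
  using pow_p_pos[of e] by (metis nat_pow_zero less_not_refl2)

lemma frobenius_pow_minus:
  assumes x: "x \<in> carrier R"
  shows "(\<ominus> x) [^] (p ^ e) = \<ominus> (x [^] (p ^ e))"
proof (rule minus_equality[symmetric])
  show "(\<ominus> x) [^] (p ^ e) \<oplus> x [^] (p ^ e) = \<zero>"
    using x frobenius_pow_add[of "\<ominus> x" x e] by (simp add: l_neg zero_pow_p)
qed (use x in auto)

end

section \<open>Primes in Noetherian rings\<close>

lemma (in noetherian_ring) exists_maximal_ideal_in:
  assumes "\<I> \<noteq> {}" "\<And>I. I \<in> \<I> \<Longrightarrow> ideal I R"
  shows "\<exists>L\<in>\<I>. \<forall>I\<in>\<I>. L \<subseteq> I \<longrightarrow> I = L"
proof (rule subset_Zorn)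
  fix C assume C: "subset.chain \<I> C"
  show "\<exists>U\<in>\<I>. \<forall>X\<in>C. X \<subseteq> U"
  proof (cases "C = {}")
    case True
    then show ?thesis using assms(1) by auto
  next
    case False
    have "subset.chain {I. ideal I R} C"
      using C assms(2) by (auto simp: subset.chain_def)
    then have "\<Union>C \<in> C" using ideal_chain_is_trivial[OF False] by simp
    then show ?thesis using C by (intro bexI[of _ "\<Union>C"]) (auto simp: subset.chain_def)
  qed
qed

lemma (in noetherian_ring) ascending_ideals_stabilise:
  assumes I: "\<And>n. ideal (I n) R" and mono: "\<And>n::nat. I n \<subseteq> I (Suc n)"
  shows "\<exists>n. \<forall>m. I m \<subseteq> I n"
proof -
  obtain L where "L \<in> range I" and L: "\<forall>J\<in>range I. L \<subseteq> J \<longrightarrow> J = L"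
    using exists_maximal_ideal_in[of "range I"] I by blast
  then obtain n where n: "L = I n" by auto
  have "I m \<subseteq> I n" for m
  proof (cases "m \<le> n")
    case True
    then show ?thesis using lift_Suc_mono_le[of I, OF mono] by blast
  next
    case False
    then have "I n \<subseteq> I m" using lift_Suc_mono_le[of I, OF mono] by simp
    then show ?thesis using L n by blast
  qed
  then show ?thesis by blast
qed

lemma (in cring) ideal_add_principal:
  assumes I: "ideal I R" and a: "a \<in> carrier R"
  defines "J \<equiv> {i \<oplus> r \<otimes> a | i r. i \<in> I \<and> r \<in> carrier R}"
  shows "ideal J R" "I \<subseteq> J" "a \<in> J"
proof -
  interpret I: ideal I R by fact
  have "J = I <+>\<^bsub>R\<^esub> PIdl a"
    by (auto simp: J_def set_add_def' cgenideal_def)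
  then show "ideal J R"
    using I add_ideals cgenideal_ideal[OF a] by simp
  show "I \<subseteq> J"
  proof
    fix i assume "i \<in> I"
    then have "i = i \<oplus> \<zero> \<otimes> a" using a I.Icarr by simp
    then show "i \<in> J" unfolding J_def using \<open>i \<in> I\<close> by blast
  qed
  have "a = \<zero> \<oplus> \<one> \<otimes> a" using a by simp
  then show "a \<in> J" unfolding J_def using I.zero_closed by blast
qed

lemma (in primeideal) pow_in_imp_in:
  assumes "a \<in> carrier R" "a [^] (n::nat) \<in> I"
  shows "a \<in> I"
  using assms(2)
proof (induction n)
  case 0
  then show ?case using one_imp_carrier I_notcarr by simp
next
  case (Suc n)
  then show ?case using assms(1) I_prime[of "a [^] n" a] by auto
qed

lemma (in ideal) pow_mono:
  assumes "a \<in> carrier R" "a [^] (n::nat) \<in> I" "n \<le> m"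
  shows "a [^] m \<in> I"
proof -
  have "a [^] m = a [^] n \<otimes> a [^] (m - n)"
    using assms by (simp add: nat_pow_mult)
  then show ?thesis using assms I_r_closed by simp
qed

text \<open>
  Noetherian induction: if \<open>I\<close> is neither prime nor the whole ring, then \<open>a \<otimes> b \<in> I\<close> for some
  \<open>a\<close> and \<open>b\<close> outside \<open>I\<close>, and finite sets of primes that serve for \<open>I + (a)\<close> and for \<open>I + (b)\<close> together serve for \<open>I\<close>.
\<close>

lemma finite_primes_for_radical:
  fixes R (structure)
  assumes "cring R" and "noetherian_ring R" and I: "ideal I R"
  shows "\<exists>\<P>. finite \<P> \<and> (\<forall>P\<in>\<P>. primeideal P R) \<and>
           (\<forall>x\<in>carrier R. (\<forall>P\<in>\<P>. x \<in> P) \<longrightarrow> (\<exists>n::nat. x [^] n \<in> I))" (is "?good I")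
proof (rule ccontr)
  interpret cring R by fact
  interpret noetherian_ring R by fact
  assume "\<not> ?good I"
  define \<B> where "\<B> = {I. ideal I R \<and> \<not> ?good I}"
  have "\<B> \<noteq> {}" using I \<open>\<not> ?good I\<close> unfolding \<B>_def by blast
  moreover have "\<And>I. I \<in> \<B> \<Longrightarrow> ideal I R" unfolding \<B>_def mem_Collect_eq by (rule conjunct1)
  ultimately obtain L where L: "L \<in> \<B>" and max: "\<forall>J\<in>\<B>. L \<subseteq> J \<longrightarrow> J = L"
    using exists_maximal_ideal_in[of \<B>] by blast
  interpret L: ideal L R using L by (simp add: \<B>_def)
  have bad: "\<not> ?good L" using L unfolding \<B>_def mem_Collect_eq by (rule conjunct2)
  have good: "?good J" if "ideal J R" "L \<subseteq> J" "a \<in> J" "a \<notin> L" for J a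
  proof (rule ccontr)
    assume "\<not> ?good J"
    then have "J \<in> \<B>" unfolding \<B>_def using that(1) by (intro CollectI conjI)
    then have "J = L" using max that(2) by blast
    then show False using that(3,4) by simp
  qed
  have "\<not> primeideal L R"
  proof
    assume "primeideal L R"
    then have "?good L" by (intro exI[of _ "{L}"]) (auto intro!: exI[of _ "1::nat"])
    then show False using bad by blast
  qed
  moreover have "carrier R \<noteq> L"
  proof
    assume "carrier R = L"
    then have "?good L" by (intro exI[of _ "{}"]) auto
    then show False using bad by blast
  qed
  ultimately obtain a b where ab: "a \<in> carrier R" "b \<in> carrier R" "a \<otimes> b \<in> L" "a \<notin> L" "b \<notin> L"
    using L.primeidealCD[OF cring_axioms] by blast
  define A where "A = {i \<oplus> r \<otimes> a | i r. i \<in> L \<and> r \<in> carrier R}"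
  define B where "B = {i \<oplus> r \<otimes> b | i r. i \<in> L \<and> r \<in> carrier R}"
  note A = ideal_add_principal[OF L.is_ideal ab(1), folded A_def]
  note B = ideal_add_principal[OF L.is_ideal ab(2), folded B_def]
  obtain \<P> where P: "finite \<P>" "\<forall>P\<in>\<P>. primeideal P R"
      "\<forall>x\<in>carrier R. (\<forall>P\<in>\<P>. x \<in> P) \<longrightarrow> (\<exists>n::nat. x [^] n \<in> A)"
    using good[OF A ab(4)] by blast
  obtain \<Q> where Q: "finite \<Q>" "\<forall>P\<in>\<Q>. primeideal P R"
      "\<forall>x\<in>carrier R. (\<forall>P\<in>\<Q>. x \<in> P) \<longrightarrow> (\<exists>n::nat. x [^] n \<in> B)"
    using good[OF B ab(5)] by blast
  have AB: "u \<otimes> v \<in> L" if uv: "u \<in> A" "v \<in> B" for u v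
  proof -
    obtain i r where u: "u = i \<oplus> r \<otimes> a" "i \<in> L" "r \<in> carrier R" using uv by (auto simp: A_def)
    obtain i' s where v: "v = i' \<oplus> s \<otimes> b" "i' \<in> L" "s \<in> carrier R" using uv by (auto simp: B_def)
    have "u \<otimes> v = i \<otimes> v \<oplus> (r \<otimes> a \<otimes> i' \<oplus> r \<otimes> s \<otimes> (a \<otimes> b))"
      using u v ab L.Icarr by (simp add: l_distr r_distr m_ac a_ac)
    moreover have "v \<in> carrier R" using v ab L.Icarr by simp
    ultimately show ?thesis
      using u v ab by (simp add: L.I_l_closed L.I_r_closed)
  qed
  have "?good L"
  proof (intro exI[of _ "\<P> \<union> \<Q>"] conjI ballI impI)
    fix x assume x: "x \<in> carrier R" "\<forall>P\<in>\<P> \<union> \<Q>. x \<in> P"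
    then obtain n m :: nat where "x [^] n \<in> A" "x [^] m \<in> B" using P(3) Q(3) by blast
    then show "\<exists>n::nat. x [^] n \<in> L"
      using AB x by (intro exI[of _ "n + m"]) (simp flip: nat_pow_mult)
  qed (use P Q in auto)
  then show False using bad by blast
qed

text \<open>A product of elements, one from each \<open>P\<close> and each outside the prime ideal \<open>I\<close>.\<close>

lemma (in primeideal) obtain_common_element_outside:
  assumes "finite \<P>" "\<And>P. P \<in> \<P> \<Longrightarrow> ideal P R" "\<And>P. P \<in> \<P> \<Longrightarrow> \<not> P \<subseteq> I"
  obtains t where "t \<in> carrier R" "t \<notin> I" "\<And>P. P \<in> \<P> \<Longrightarrow> t \<in> P"
proof -
  have "\<exists>t\<in>carrier R. t \<notin> I \<and> (\<forall>P\<in>\<P>. t \<in> P)"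
    using assms
  proof (induction)
    case empty
    then show ?case using I_notcarr one_imp_carrier by (intro bexI[of _ \<one>]) auto
  next
    case (insert P \<P>)
    then obtain t where t: "t \<in> carrier R" "t \<notin> I" "\<And>P. P \<in> \<P> \<Longrightarrow> t \<in> P" by (metis insertCI)
    obtain a where a: "a \<in> P" "a \<notin> I" using insert.prems by blast
    interpret P: ideal P R using insert.prems by simp
    have "t \<otimes> a \<in> Q" if "Q \<in> insert P \<P>" for Q
      using that t a P.I_l_closed ideal.I_r_closed[OF insert.prems(1)[OF that]] P.Icarr by blast
    then show ?case
      using t a P.Icarr I_prime[of t a] by (intro bexI[of _ "t \<otimes> a"]) auto
  qed
  then show ?thesis using that by blast
qed

text \<open>
  Every prime contains one of the finitely many primes obtained for the zero ideal, so the minimal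
  primes are found among these.
\<close>

lemma minimal_prime_below_and_finite:
  fixes R (structure)
  assumes "cring R" and "noetherian_ring R"
  shows finite_minimal_primes: "finite {Q. minimal_prime Q R}"
    and minimal_prime_below: "primeideal Q R \<Longrightarrow> \<exists>P. minimal_prime P R \<and> P \<subseteq> Q"
    and minimal_primes_inter_nilradical:
      "x \<in> carrier R \<Longrightarrow> (\<And>Q. minimal_prime Q R \<Longrightarrow> x \<in> Q) \<Longrightarrow> x \<in> nilradical R"
proof -
  interpret cring R by fact
  interpret noetherian_ring R by fact
  obtain \<P> where P: "finite \<P>" "\<And>P. P \<in> \<P> \<Longrightarrow> primeideal P R"
      "\<And>x. x \<in> carrier R \<Longrightarrow> (\<And>P. P \<in> \<P> \<Longrightarrow> x \<in> P) \<Longrightarrow> \<exists>n::nat. x [^] n = \<zero>"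
    using finite_primes_for_radical[OF assms zeroideal] by auto
  have contains: "\<exists>P\<in>\<P>. P \<subseteq> Q" if "primeideal Q R" for Q
  proof (rule ccontr)
    interpret Q: primeideal Q R by fact
    assume "\<not> ?thesis"
    then obtain t where t: "t \<in> carrier R" "t \<notin> Q" "\<And>P. P \<in> \<P> \<Longrightarrow> t \<in> P"
      using Q.obtain_common_element_outside[of \<P>] P primeideal.axioms(1) by metis
    then obtain n :: nat where "t [^] n = \<zero>" using P by blast
    then show False using t Q.pow_in_imp_in[of t n] Q.zero_closed by simp
  qed
  show "finite {Q. minimal_prime Q R}"
  proof (rule finite_subset[OF _ P(1)], rule subsetI)
    fix Q assume "Q \<in> {Q. minimal_prime Q R}"
    then show "Q \<in> \<P>" using P(2) contains[of Q] unfolding minimal_prime_def by blast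
  qed
  have below: "\<exists>P. minimal_prime P R \<and> P \<subseteq> Q" if Q: "primeideal Q R" for Q
  proof -
    have "finite {P\<in>\<P>. P \<subseteq> Q}" "{P\<in>\<P>. P \<subseteq> Q} \<noteq> {}" using P(1) contains[OF Q] by auto
    from finite_has_minimal[OF this] obtain P where "P \<in> {P\<in>\<P>. P \<subseteq> Q}"
        and min: "\<forall>P'\<in>{P\<in>\<P>. P \<subseteq> Q}. P' \<subseteq> P \<longrightarrow> P = P'"
      by (rule bexE)
    then have PQ: "P \<in> \<P>" "P \<subseteq> Q" by auto
    have "P' = P" if P': "primeideal P' R" "P' \<subseteq> P" for P'
    proof -
      obtain P'' where "P'' \<in> \<P>" "P'' \<subseteq> P'" using contains[OF P'(1)] by blast
      then show ?thesis using min P'(2) PQ(2) by blast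
    qed
    then have "minimal_prime P R"
      unfolding minimal_prime_def using PQ P(2) by blast
    then show ?thesis using PQ by blast
  qed
  then show "primeideal Q R \<Longrightarrow> \<exists>P. minimal_prime P R \<and> P \<subseteq> Q" .
  show "x \<in> nilradical R" if "x \<in> carrier R" "\<And>Q. minimal_prime Q R \<Longrightarrow> x \<in> Q"
  proof -
    have "x \<in> P" if "P \<in> \<P>" for P
      using below[OF P(2)[OF that]] \<open>\<And>Q. minimal_prime Q R \<Longrightarrow> x \<in> Q\<close> by blast
    then show ?thesis using P(3) \<open>x \<in> carrier R\<close> unfolding nilradical_def by blast
  qed
qed

text \<open>
  Prime avoidance. If \<open>x\<close> avoids the primes other than \<open>Q\<close> but lies in \<open>Q\<close>, then it is corrected
  by a multiple of an element of \<open>I\<close> outside \<open>Q\<close>, the factor being chosen in all the other primes.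
\<close>

lemma (in cring) prime_avoidance:
  assumes "ideal I R" and "finite \<P>" and "\<And>P. P \<in> \<P> \<Longrightarrow> primeideal P R"
    and "\<And>P Q. P \<in> \<P> \<Longrightarrow> Q \<in> \<P> \<Longrightarrow> P \<subseteq> Q \<Longrightarrow> P = Q"
    and "\<And>P. P \<in> \<P> \<Longrightarrow> \<not> I \<subseteq> P"
  shows "\<exists>x\<in>I. \<forall>P\<in>\<P>. x \<notin> P"
proof -
  interpret I: ideal I R by fact
  show ?thesis using assms(2-)
  proof (induction)
    case empty
    show ?case by (rule bexI[OF _ I.zero_closed]) simp
  next
    case (insert Q \<P>)
    have "\<exists>x\<in>I. \<forall>P\<in>\<P>. x \<notin> P"
      by (rule insert.IH) (use insert.prems in simp_all)
    then obtain x where x: "x \<in> I" "\<And>P. P \<in> \<P> \<Longrightarrow> x \<notin> P" by blast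
    show ?case
    proof (cases "x \<in> Q")
      case True
      interpret Q: primeideal Q R by (rule insert.prems(1)[OF insertI1])
      obtain y where y: "y \<in> I" "y \<notin> Q" using insert.prems(3)[OF insertI1] by blast
      have not_le: "\<not> P \<subseteq> Q" if "P \<in> \<P>" for P
        using insert.prems(2)[of P Q] insert.hyps(2) that by auto
      have ideals: "ideal P R" if "P \<in> \<P>" for P
        using insert.prems(1)[of P] that primeideal.axioms(1) by blast
      obtain t where t: "t \<in> carrier R" "t \<notin> Q" "\<And>P. P \<in> \<P> \<Longrightarrow> t \<in> P"
        using Q.obtain_common_element_outside[OF insert.hyps(1) ideals not_le] by blast
      have car: "x \<in> carrier R" "y \<in> carrier R" "t \<otimes> y \<in> carrier R" using x y t I.Icarr by auto
      have "x \<oplus> t \<otimes> y \<notin> P" if P: "P \<in> insert Q \<P>" for P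
      proof
        assume in_P: "x \<oplus> t \<otimes> y \<in> P"
        interpret P: primeideal P R by (rule insert.prems(1)[OF P])
        show False
        proof (cases "P = Q")
          case True
          have "t \<otimes> y = (x \<oplus> t \<otimes> y) \<ominus> x" using car by algebra
          then have "t \<otimes> y \<in> Q" using in_P \<open>x \<in> Q\<close> True
            by (metis P.a_inv_closed P.a_closed a_minus_def)
          then show False using Q.I_prime t y car by blast
        next
          case False
          then have "t \<otimes> y \<in> P" using P t car by (auto intro: P.I_r_closed)
          moreover have "x = (x \<oplus> t \<otimes> y) \<ominus> t \<otimes> y" using car by algebra
          ultimately have "x \<in> P" using in_P by (metis P.a_inv_closed P.a_closed a_minus_def)
          then show False using x P False by blast
        qed
      qed
      moreover have "x \<oplus> t \<otimes> y \<in> I"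
        using I.a_closed[OF x(1) I.I_l_closed[OF y(1) t(1)]] .
      ultimately show ?thesis by (intro bexI[of _ "x \<oplus> t \<otimes> y"] ballI)
    qed (use x in auto)
  qed
qed

lemma primeideal_vimage:
  assumes j: "j \<in> ring_hom R S" and "cring R" "cring S" and Q: "primeideal Q S"
  shows "primeideal {r \<in> carrier R. j r \<in> Q} R"
proof -
  interpret R: cring R by fact
  interpret S: cring S by fact
  interpret j: ring_hom_cring R S j
    by unfold_locales (rule j)
  interpret Q: primeideal Q S by fact
  have sub: "subgroup {r \<in> carrier R. j r \<in> Q} (add_monoid R)"
  proof (rule R.add.subgroupI)
    show "{r \<in> carrier R. j r \<in> Q} \<noteq> {}"
      using Q.zero_closed by (auto intro!: exI[of _ "\<zero>\<^bsub>R\<^esub>"])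
  qed (auto)
  have "ideal {r \<in> carrier R. j r \<in> Q} R"
    by (rule idealI[OF R.ring_axioms sub]) (auto intro: Q.I_l_closed Q.I_r_closed)
  moreover have "carrier R \<noteq> {r \<in> carrier R. j r \<in> Q}"
  proof
    assume "carrier R = {r \<in> carrier R. j r \<in> Q}"
    then have "\<one>\<^bsub>R\<^esub> \<in> {r \<in> carrier R. j r \<in> Q}" by (metis R.one_closed)
    then show False using Q.one_imp_carrier Q.I_notcarr by simp
  qed
  ultimately show ?thesis
    by (rule primeidealI[OF _ R.is_cring]) (simp_all, metis Q.I_prime j.hom_closed)
qed


section \<open>A Krull intersection argument for Frobenius powers\<close>

locale noetherian_prime_char_ring = prime_char_ring R p + noetherian_ring R
  for R (structure) and p :: nat
begin

lemma frobenius_preimage_ideal: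
  assumes "ideal L R"
  shows "ideal {x \<in> carrier R. x [^] (p ^ e) \<in> L} R"
proof -
  interpret L: ideal L R by fact
  show ?thesis
  proof (rule idealI[OF ring_axioms])
    show "subgroup {x \<in> carrier R. x [^] (p ^ e) \<in> L} (add_monoid R)"
    proof (rule add.subgroupI)
      have "\<zero> \<in> {x \<in> carrier R. x [^] (p ^ e) \<in> L}" by (simp add: zero_pow_p)
      then show "{x \<in> carrier R. x [^] (p ^ e) \<in> L} \<noteq> {}" by (metis empty_iff)
    qed (auto simp: frobenius_pow_minus frobenius_pow_add)
  qed (auto simp: nat_pow_distrib L.I_l_closed L.I_r_closed)
qed

text \<open>
  The ideals \<open>{x. x\<^bsup>p\<^sup>e\<^esup> \<in> L}\<close> increase with \<open>e\<close>, so one exponent serves for all \<open>x\<close> that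
  are nilpotent modulo \<open>L\<close>.
\<close>

lemma frobenius_preimages_stabilise:
  assumes "ideal L R"
  obtains e where "\<And>x n. x \<in> carrier R \<Longrightarrow> x [^] (n::nat) \<in> L \<Longrightarrow> x [^] (p ^ e) \<in> L"
proof -
  interpret L: ideal L R by fact
  let ?E = "\<lambda>e. {x \<in> carrier R. x [^] (p ^ e) \<in> L}"
  have le: "p ^ e \<le> p ^ Suc e" for e using prime_ge_1_nat[OF prime_p] by simp
  have mono: "?E e \<subseteq> ?E (Suc e)" for e
    using L.pow_mono[OF _ _ le] by blast
  obtain e where e: "\<And>m. ?E m \<subseteq> ?E e"
    using ascending_ideals_stabilise[of ?E, OF frobenius_preimage_ideal[OF assms] mono] by blast
  have "x [^] (p ^ e) \<in> L" if x: "x \<in> carrier R" "x [^] n \<in> L" for x and n :: nat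
  proof -
    have "n \<le> p ^ n"
      using less_exp[of n] power_mono[OF prime_ge_2_nat[OF prime_p], of n] by linarith
    then have "x \<in> ?E n" using L.pow_mono x by blast
    then show ?thesis using e by blast
  qed
  then show ?thesis using that by blast
qed

text \<open>
  Localised at \<open>P\<close>, modulo \<open>P\<^sub>0\<close>, the claim is that a nonzero element \<open>c\<close> lies outside the
  ideal generated by the \<open>p\<^sup>e\<close>-th powers of \<open>P\<close> when \<open>e\<close> is large.  By Nakayama's lemma
  \<open>c \<notin> P c\<close>, so there is an ideal \<open>L\<close> that contains \<open>P c\<close> and is maximal among those that
  avoid \<open>c\<close>.  For \<open>a \<in> P\<close> the ideals \<open>L : a\<^sup>n\<close> become stationary; if \<open>a\<^sup>n \<notin> L\<close>, then
  \<open>c \<in> L + (a\<^sup>n)\<close> by maximality, and multiplication by \<open>a\<close> followed by cancellation gives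
  \<open>c \<in> L\<close>.  Hence every element of \<open>P\<close> is nilpotent modulo \<open>L\<close>.  Below, avoiding \<open>c\<close> in the
  localisation is expressed by \<open>s \<otimes> c \<in> L \<Longrightarrow> s \<in> P\<close>.
\<close>

lemma obtain_ideal_avoiding_element:
  assumes P0: "primeideal P\<^sub>0 R" and P: "primeideal P R" and sub: "P\<^sub>0 \<subseteq> P"
    and c: "c \<in> carrier R" "c \<notin> P\<^sub>0"
  obtains L e where "ideal L R" "P\<^sub>0 \<subseteq> L" "\<And>s. s \<in> carrier R \<Longrightarrow> s \<otimes> c \<in> L \<Longrightarrow> s \<in> P"
    "\<And>x. x \<in> P \<Longrightarrow> x [^] (p ^ e) \<in> L"
proof -
  interpret P0: primeideal P\<^sub>0 R by fact
  interpret P: primeideal P R by fact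
  define \<I> where "\<I> = {L. ideal L R \<and> P\<^sub>0 \<subseteq> L \<and> (\<forall>x\<in>P. x \<otimes> c \<in> L) \<and>
      (\<forall>s\<in>carrier R. s \<otimes> c \<in> L \<longrightarrow> s \<in> P)}"
  define L0 where "L0 = P\<^sub>0 <+>\<^bsub>R\<^esub> {x \<otimes> c | x. x \<in> P}"
  have "ideal {x \<otimes> c | x. x \<in> P} R"
  proof (rule idealI[OF ring_axioms])
    show "subgroup {x \<otimes> c | x. x \<in> P} (add_monoid R)"
    proof (rule add.subgroupI)
      have "\<zero> \<otimes> c \<in> {x \<otimes> c | x. x \<in> P}" using P.zero_closed by blast
      then show "{x \<otimes> c | x. x \<in> P} \<noteq> {}" by (metis empty_iff)
    next
      fix u assume "u \<in> {x \<otimes> c | x. x \<in> P}"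
      then obtain x where "x \<in> P" "u = x \<otimes> c" by auto
      then have "\<ominus> x \<in> P" "\<ominus> u = \<ominus> x \<otimes> c"
        using c P.Icarr by (auto simp: l_minus)
      then show "\<ominus> u \<in> {x \<otimes> c | x. x \<in> P}" by auto
    next
      fix u v assume "u \<in> {x \<otimes> c | x. x \<in> P}" "v \<in> {x \<otimes> c | x. x \<in> P}"
      then obtain x y where "x \<in> P" "u = x \<otimes> c" "y \<in> P" "v = y \<otimes> c" by auto
      then have "x \<oplus> y \<in> P" "u \<oplus> v = (x \<oplus> y) \<otimes> c" using c P.Icarr by (auto simp: l_distr)
      then show "u \<oplus> v \<in> {x \<otimes> c | x. x \<in> P}" by auto
    qed (use c P.Icarr in auto)
    fix u r assume "u \<in> {x \<otimes> c | x. x \<in> P}" and r: "r \<in> carrier R"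
    then obtain x where x: "x \<in> P" "u = x \<otimes> c" by auto
    have "r \<otimes> x \<in> P" using x r P.I_l_closed by blast
    moreover have "r \<otimes> u = r \<otimes> x \<otimes> c" "u \<otimes> r = r \<otimes> x \<otimes> c"
      using x r c P.Icarr by (auto simp: m_ac)
    ultimately show "r \<otimes> u \<in> {x \<otimes> c | x. x \<in> P}" "u \<otimes> r \<in> {x \<otimes> c | x. x \<in> P}" by auto
  qed
  then have "ideal L0 R" unfolding L0_def by (rule add_ideals[OF P0.is_ideal])
  moreover have "x \<in> L0" if "x \<in> P\<^sub>0" for x
  proof -
    have "x = x \<oplus> \<zero> \<otimes> c" using P0.Icarr[OF that] c by simp
    then show ?thesis unfolding L0_def set_add_def' using that P.zero_closed by blast
  qed
  moreover have "x \<otimes> c \<in> L0" if "x \<in> P" for x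
  proof -
    have "x \<otimes> c = \<zero> \<oplus> x \<otimes> c" using P.Icarr[OF that] c by simp
    then show ?thesis unfolding L0_def set_add_def' using that P0.zero_closed by blast
  qed
  \<comment> \<open>The cyclic case of Nakayama's lemma: if \<open>s c\<close> agrees with \<open>x c\<close> modulo \<open>P\<^sub>0\<close> for some \<open>x \<in> P\<close>,
    then \<open>s \<ominus> x\<close> kills the nonzero element \<open>c\<close> of the domain \<open>R / P\<^sub>0\<close>.\<close>
  moreover have "s \<in> P" if s: "s \<in> carrier R" "s \<otimes> c \<in> L0" for s
  proof -
    obtain i x where ix: "i \<in> P\<^sub>0" "x \<in> P" "s \<otimes> c = i \<oplus> x \<otimes> c"
      using s(2) unfolding L0_def set_add_def' by auto
    have car: "i \<in> carrier R" "x \<in> carrier R" using ix P0.Icarr P.Icarr by auto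
    have "(s \<ominus> x) \<otimes> c = s \<otimes> c \<ominus> x \<otimes> c" using s c car by algebra
    also have "\<dots> = i" unfolding ix(3) using c car by algebra
    finally have "(s \<ominus> x) \<otimes> c \<in> P\<^sub>0" using ix by simp
    then have "s \<ominus> x \<in> P" using P0.I_prime[of "s \<ominus> x" c] c s car sub by auto
    moreover have "s = (s \<ominus> x) \<oplus> x" using s car by algebra
    ultimately show ?thesis using ix P.a_closed by metis
  qed
  ultimately have "\<I> \<noteq> {}" unfolding \<I>_def by blast
  moreover have "\<And>I. I \<in> \<I> \<Longrightarrow> ideal I R" unfolding \<I>_def by blast
  ultimately obtain L where LI: "L \<in> \<I>" and max: "\<forall>J\<in>\<I>. L \<subseteq> J \<longrightarrow> J = L"
    using exists_maximal_ideal_in[of \<I>] by blast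
  interpret L: ideal L R using LI unfolding \<I>_def by blast
  have L: "P\<^sub>0 \<subseteq> L" "\<And>x. x \<in> P \<Longrightarrow> x \<otimes> c \<in> L"
      "\<And>s. s \<in> carrier R \<Longrightarrow> s \<otimes> c \<in> L \<Longrightarrow> s \<in> P"
    using LI unfolding \<I>_def by blast+
  have nilpotent: "\<exists>n::nat. a [^] n \<in> L" if a: "a \<in> P" for a
  proof -
    have ac: "a \<in> carrier R" using a P.Icarr by blast
    define K where "K n = {y \<in> carrier R. a [^] n \<otimes> y \<in> L}" for n :: nat
    have "ideal (K n) R" for n
    proof (rule idealI[OF ring_axioms])
      show "subgroup (K n) (add_monoid R)"
      proof (rule add.subgroupI)
        have "\<zero> \<in> K n" using ac by (simp add: K_def)
        then show "K n \<noteq> {}" by (metis empty_iff)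
      qed (use ac in \<open>auto simp: K_def r_minus r_distr simp flip: a_inv_def\<close>)
    next
      fix y r assume y: "y \<in> K n" and r: "r \<in> carrier R"
      have "a [^] n \<otimes> (r \<otimes> y) = r \<otimes> (a [^] n \<otimes> y)" "y \<otimes> r = r \<otimes> y"
        using y r ac by (auto simp: K_def m_ac)
      then show "r \<otimes> y \<in> K n" "y \<otimes> r \<in> K n" using y r L.I_l_closed by (auto simp: K_def)
    qed
    moreover have "K n \<subseteq> K (Suc n)" for n
    proof
      fix y assume y: "y \<in> K n"
      have "a [^] Suc n \<otimes> y = a \<otimes> (a [^] n \<otimes> y)" using y ac by (simp add: K_def m_ac)
      then show "y \<in> K (Suc n)" using y ac L.I_l_closed by (simp add: K_def)
    qed
    ultimately obtain n where n: "\<And>m. K m \<subseteq> K n"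
      using ascending_ideals_stabilise[of K] by blast
    have "a [^] n \<in> L"
    proof (rule ccontr)
      assume notin: "a [^] n \<notin> L"
      define J where "J = {i \<oplus> r \<otimes> a [^] n | i r. i \<in> L \<and> r \<in> carrier R}"
      have an: "a [^] n \<in> carrier R" using ac by simp
      note J = ideal_add_principal[OF L.is_ideal an, folded J_def]
      have "J \<notin> \<I>" using max J(2,3) notin by blast
      then obtain s where s: "s \<in> carrier R" "s \<otimes> c \<in> J" "s \<notin> P"
        unfolding \<I>_def using J L(1,2) by blast
      then obtain l r where lr: "s \<otimes> c = l \<oplus> r \<otimes> a [^] n" "l \<in> L" "r \<in> carrier R"
        unfolding J_def by blast
      have lc: "l \<in> carrier R" using lr L.Icarr by blast
      have "a [^] Suc n \<otimes> r = a \<otimes> (l \<oplus> r \<otimes> a [^] n) \<ominus> a \<otimes> l"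
        unfolding nat_pow_Suc using an ac lr(3) lc by algebra
      also have "\<dots> = s \<otimes> (a \<otimes> c) \<ominus> a \<otimes> l"
        unfolding lr(1)[symmetric] using ac lc s(1) c by algebra
      also have "\<dots> \<in> L"
        unfolding a_minus_def
        by (rule L.a_closed[OF L.I_l_closed[OF L(2)[OF a] s(1)] L.a_inv_closed[OF L.I_l_closed[OF lr(2) ac]]])
      finally have "r \<in> K n" using n[of "Suc n"] lr(3) by (auto simp: K_def)
      then have "r \<otimes> a [^] n \<in> L" using lr(3) an by (simp add: K_def m_comm)
      then have "s \<otimes> c \<in> L" unfolding lr(1) using lr(2) by simp
      then show False using L(3) s by blast
    qed
    then show ?thesis by blast
  qed
  obtain e where e: "\<And>x n. x \<in> carrier R \<Longrightarrow> x [^] (n::nat) \<in> L \<Longrightarrow> x [^] (p ^ e) \<in> L"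
    using frobenius_preimages_stabilise[OF L.is_ideal] by blast
  have "x [^] (p ^ e) \<in> L" if "x \<in> P" for x
    using nilpotent[OF that] e P.Icarr[OF that] by blast
  with L.is_ideal L(1,3) that show ?thesis by blast
qed

end


section \<open>Functionals modulo a prime\<close>

context module
begin

text \<open>
  Graph of a partial \<open>R\<close>-linear functional from \<open>M / L\<close> to \<open>R / P\<close>, with values represented by
  elements of \<open>R\<close>: for a relation closed under the module operations, being single-valued
  modulo \<open>P\<close> amounts to the condition on pairs \<open>(\<zero>\<^bsub>M\<^esub>, r)\<close>.
\<close>

definition partial_functional :: "'c set \<Rightarrow> 'a set \<Rightarrow> ('c \<times> 'a) set \<Rightarrow> bool" where
  "partial_functional L P \<Gamma> \<longleftrightarrow> \<Gamma> \<subseteq> carrier M \<times> carrier R \<and> (\<forall>l\<in>L. (l, \<zero>) \<in> \<Gamma>) \<and>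
     (\<forall>x r y s. (x, r) \<in> \<Gamma> \<longrightarrow> (y, s) \<in> \<Gamma> \<longrightarrow> (x \<oplus>\<^bsub>M\<^esub> y, r \<oplus> s) \<in> \<Gamma>) \<and>
     (\<forall>x r. \<forall>a\<in>carrier R. (x, r) \<in> \<Gamma> \<longrightarrow> (a \<odot>\<^bsub>M\<^esub> x, a \<otimes> r) \<in> \<Gamma>) \<and>
     (\<forall>r. (\<zero>\<^bsub>M\<^esub>, r) \<in> \<Gamma> \<longrightarrow> r \<in> P)"

lemma partial_functionalI:
  assumes "\<And>x r. (x, r) \<in> \<Gamma> \<Longrightarrow> x \<in> carrier M \<and> r \<in> carrier R" "\<And>l. l \<in> L \<Longrightarrow> (l, \<zero>) \<in> \<Gamma>"
    "\<And>x r y s. (x, r) \<in> \<Gamma> \<Longrightarrow> (y, s) \<in> \<Gamma> \<Longrightarrow> (x \<oplus>\<^bsub>M\<^esub> y, r \<oplus> s) \<in> \<Gamma>"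
    "\<And>x r a. a \<in> carrier R \<Longrightarrow> (x, r) \<in> \<Gamma> \<Longrightarrow> (a \<odot>\<^bsub>M\<^esub> x, a \<otimes> r) \<in> \<Gamma>"
    "\<And>r. (\<zero>\<^bsub>M\<^esub>, r) \<in> \<Gamma> \<Longrightarrow> r \<in> P"
  shows "partial_functional L P \<Gamma>"
  using assms unfolding partial_functional_def by auto

lemma partial_functionalD:
  assumes "partial_functional L P \<Gamma>"
  shows "(x, r) \<in> \<Gamma> \<Longrightarrow> x \<in> carrier M" "(x, r) \<in> \<Gamma> \<Longrightarrow> r \<in> carrier R" "l \<in> L \<Longrightarrow> (l, \<zero>) \<in> \<Gamma>"
    "(x, r) \<in> \<Gamma> \<Longrightarrow> (y, s) \<in> \<Gamma> \<Longrightarrow> (x \<oplus>\<^bsub>M\<^esub> y, r \<oplus> s) \<in> \<Gamma>"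
    "a \<in> carrier R \<Longrightarrow> (x, r) \<in> \<Gamma> \<Longrightarrow> (a \<odot>\<^bsub>M\<^esub> x, a \<otimes> r) \<in> \<Gamma>"
    "(\<zero>\<^bsub>M\<^esub>, r) \<in> \<Gamma> \<Longrightarrow> r \<in> P"
  using assms unfolding partial_functional_def by auto

lemma partial_functional_minus:
  assumes "partial_functional L P \<Gamma>" "(x, r) \<in> \<Gamma>"
  shows "(\<ominus>\<^bsub>M\<^esub> x, \<ominus> r) \<in> \<Gamma>"
proof -
  have "x \<in> carrier M" "r \<in> carrier R" using partial_functionalD[OF assms(1)] assms(2) by auto
  then have "\<ominus> \<one> \<odot>\<^bsub>M\<^esub> x = \<ominus>\<^bsub>M\<^esub> x" "\<ominus> \<one> \<otimes> r = \<ominus> r" by (auto simp: smult_l_minus l_minus)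
  then show ?thesis using partial_functionalD(5)[OF assms(1) _ assms(2), of "\<ominus> \<one>"] by simp
qed

lemma partial_functional_cong:
  assumes "partial_functional L P \<Gamma>" "(x, r) \<in> \<Gamma>" "(x, s) \<in> \<Gamma>"
  shows "r \<ominus> s \<in> P"
proof -
  have "x \<in> carrier M" using partial_functionalD(1)[OF assms(1,2)] .
  then have "(\<zero>\<^bsub>M\<^esub>, r \<ominus> s) \<in> \<Gamma>"
    using partial_functionalD(4)[OF assms(1,2) partial_functional_minus[OF assms(1,3)]]
    by (simp add: M.r_neg a_minus_def)
  then show ?thesis using partial_functionalD(6)[OF assms(1)] by blast
qed

text \<open>
  If \<open>a \<odot> v\<close> is in the domain for some \<open>a \<notin> P\<close>, with value \<open>s\<close>, then the extension to \<open>v\<close> ought to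
  take the value \<open>s / a\<close> there; passing to \<open>a\<close> times the functional clears this denominator.
  Otherwise \<open>v\<close> is independent of the domain and may be sent to zero.
\<close>

lemma partial_functional_extend:
  assumes P: "primeideal P R" and PL: "\<And>a x. a \<in> P \<Longrightarrow> x \<in> carrier M \<Longrightarrow> a \<odot>\<^bsub>M\<^esub> x \<in> L"
    and \<Gamma>: "partial_functional L P \<Gamma>" and v: "v \<in> carrier M"
    and L0: "\<zero>\<^bsub>M\<^esub> \<in> L"
  shows "\<exists>\<Gamma>'. partial_functional L P \<Gamma>' \<and> v \<in> Domain \<Gamma>' \<and>
           (\<forall>x r. (x, r) \<in> \<Gamma> \<longrightarrow> (\<exists>a\<in>carrier R - P. (x, a \<otimes> r) \<in> \<Gamma>'))"
proof -
  interpret P: primeideal P R by fact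
  note \<Gamma>D = partial_functionalD[OF \<Gamma>]
  have zero: "(\<zero>\<^bsub>M\<^esub>, \<zero>) \<in> \<Gamma>" using \<Gamma>D(3) L0 by blast
  have onP: "\<one> \<notin> P" using P.one_imp_carrier P.I_notcarr by auto
  show ?thesis
  proof (cases "\<exists>a\<in>carrier R - P. a \<odot>\<^bsub>M\<^esub> v \<in> Domain \<Gamma>")
    case True
    then obtain a s where a: "a \<in> carrier R" "a \<notin> P" and s: "(a \<odot>\<^bsub>M\<^esub> v, s) \<in> \<Gamma>" by blast
    have sc: "s \<in> carrier R" using \<Gamma>D(2)[OF s] .
    define \<Gamma>' where "\<Gamma>' = {(x \<oplus>\<^bsub>M\<^esub> b \<odot>\<^bsub>M\<^esub> v, a \<otimes> r \<oplus> b \<otimes> s) | x r b. (x, r) \<in> \<Gamma> \<and> b \<in> carrier R}"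
    have in\<Gamma>': "(x \<oplus>\<^bsub>M\<^esub> b \<odot>\<^bsub>M\<^esub> v, a \<otimes> r \<oplus> b \<otimes> s) \<in> \<Gamma>'" if "(x, r) \<in> \<Gamma>" "b \<in> carrier R" for x r b
      unfolding \<Gamma>'_def using that by blast
    have old: "(x, a \<otimes> r) \<in> \<Gamma>'" if xr: "(x, r) \<in> \<Gamma>" for x r
      using in\<Gamma>'[OF xr R.zero_closed] \<Gamma>D(1,2)[OF xr] a sc v by simp
    have "partial_functional L P \<Gamma>'"
    proof (rule partial_functionalI)
      fix x r assume "(x, r) \<in> \<Gamma>'"
      then show "x \<in> carrier M \<and> r \<in> carrier R"
        unfolding \<Gamma>'_def using \<Gamma>D(1,2) a sc v by auto
    next
      fix l assume "l \<in> L"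
      then show "(l, \<zero>) \<in> \<Gamma>'" using old[OF \<Gamma>D(3)] a by simp
    next
      fix x1 r1 x2 r2 assume "(x1, r1) \<in> \<Gamma>'" "(x2, r2) \<in> \<Gamma>'"
      then obtain y1 t1 b1 y2 t2 b2 where
        1: "x1 = y1 \<oplus>\<^bsub>M\<^esub> b1 \<odot>\<^bsub>M\<^esub> v" "r1 = a \<otimes> t1 \<oplus> b1 \<otimes> s" "(y1, t1) \<in> \<Gamma>" "b1 \<in> carrier R" and
        2: "x2 = y2 \<oplus>\<^bsub>M\<^esub> b2 \<odot>\<^bsub>M\<^esub> v" "r2 = a \<otimes> t2 \<oplus> b2 \<otimes> s" "(y2, t2) \<in> \<Gamma>" "b2 \<in> carrier R"
        unfolding \<Gamma>'_def by blast
      have "x1 \<oplus>\<^bsub>M\<^esub> x2 = (y1 \<oplus>\<^bsub>M\<^esub> y2) \<oplus>\<^bsub>M\<^esub> (b1 \<oplus> b2) \<odot>\<^bsub>M\<^esub> v"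
        using 1 2 \<Gamma>D(1)[OF 1(3)] \<Gamma>D(1)[OF 2(3)] v by (simp add: smult_l_distr M.a_ac)
      moreover have "r1 \<oplus> r2 = a \<otimes> (t1 \<oplus> t2) \<oplus> (b1 \<oplus> b2) \<otimes> s"
        using 1 2 \<Gamma>D(2)[OF 1(3)] \<Gamma>D(2)[OF 2(3)] a sc by (simp add: l_distr r_distr R.a_ac)
      ultimately show "(x1 \<oplus>\<^bsub>M\<^esub> x2, r1 \<oplus> r2) \<in> \<Gamma>'"
        using in\<Gamma>'[OF \<Gamma>D(4)[OF 1(3) 2(3)], of "b1 \<oplus> b2"] 1 2 by simp
    next
      fix x1 r1 d assume d: "d \<in> carrier R" and "(x1, r1) \<in> \<Gamma>'"
      then obtain y1 t1 b1 where
        1: "x1 = y1 \<oplus>\<^bsub>M\<^esub> b1 \<odot>\<^bsub>M\<^esub> v" "r1 = a \<otimes> t1 \<oplus> b1 \<otimes> s" "(y1, t1) \<in> \<Gamma>" "b1 \<in> carrier R"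
        unfolding \<Gamma>'_def by blast
      have "d \<odot>\<^bsub>M\<^esub> x1 = (d \<odot>\<^bsub>M\<^esub> y1) \<oplus>\<^bsub>M\<^esub> (d \<otimes> b1) \<odot>\<^bsub>M\<^esub> v"
        using 1 \<Gamma>D(1)[OF 1(3)] v d by (simp add: smult_r_distr smult_assoc1)
      moreover have "d \<otimes> r1 = a \<otimes> (d \<otimes> t1) \<oplus> (d \<otimes> b1) \<otimes> s"
        using 1 \<Gamma>D(2)[OF 1(3)] a sc d by (simp add: r_distr R.m_ac)
      ultimately show "(d \<odot>\<^bsub>M\<^esub> x1, d \<otimes> r1) \<in> \<Gamma>'"
        using in\<Gamma>'[OF \<Gamma>D(5)[OF d 1(3)], of "d \<otimes> b1"] 1 d by simp
    next
      fix r assume "(\<zero>\<^bsub>M\<^esub>, r) \<in> \<Gamma>'"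
      then obtain y t b where
        1: "\<zero>\<^bsub>M\<^esub> = y \<oplus>\<^bsub>M\<^esub> b \<odot>\<^bsub>M\<^esub> v" "r = a \<otimes> t \<oplus> b \<otimes> s" "(y, t) \<in> \<Gamma>" "b \<in> carrier R"
        unfolding \<Gamma>'_def by blast
      have "a \<odot>\<^bsub>M\<^esub> y \<oplus>\<^bsub>M\<^esub> b \<odot>\<^bsub>M\<^esub> (a \<odot>\<^bsub>M\<^esub> v) = a \<odot>\<^bsub>M\<^esub> (y \<oplus>\<^bsub>M\<^esub> b \<odot>\<^bsub>M\<^esub> v)"
        using \<Gamma>D(1)[OF 1(3)] 1(4) a v
        by (simp add: smult_r_distr R.m_comm flip: smult_assoc1)
      also have "\<dots> = \<zero>\<^bsub>M\<^esub>" using a by (simp flip: 1(1))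
      finally show "r \<in> P"
        using \<Gamma>D(4)[OF \<Gamma>D(5)[OF a(1) 1(3)] \<Gamma>D(5)[OF 1(4) s]] \<Gamma>D(6) 1(2) by simp
    qed
    moreover have "v \<in> Domain \<Gamma>'"
      using in\<Gamma>'[OF zero R.one_closed] v a sc by auto
    ultimately show ?thesis using old a by blast
  next
    case False
    define \<Gamma>' where "\<Gamma>' = {(x \<oplus>\<^bsub>M\<^esub> b \<odot>\<^bsub>M\<^esub> v, r) | x r b. (x, r) \<in> \<Gamma> \<and> b \<in> carrier R}"
    have in\<Gamma>': "(x \<oplus>\<^bsub>M\<^esub> b \<odot>\<^bsub>M\<^esub> v, r) \<in> \<Gamma>'" if "(x, r) \<in> \<Gamma>" "b \<in> carrier R" for x r b
      unfolding \<Gamma>'_def using that by blast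
    have old: "(x, r) \<in> \<Gamma>'" if xr: "(x, r) \<in> \<Gamma>" for x r
      using in\<Gamma>'[OF xr R.zero_closed] \<Gamma>D(1)[OF xr] v by simp
    have "partial_functional L P \<Gamma>'"
    proof (rule partial_functionalI)
      fix x r assume "(x, r) \<in> \<Gamma>'"
      then show "x \<in> carrier M \<and> r \<in> carrier R"
        unfolding \<Gamma>'_def using \<Gamma>D(1,2) v by auto
    next
      fix l assume "l \<in> L"
      then show "(l, \<zero>) \<in> \<Gamma>'" using old[OF \<Gamma>D(3)] by simp
    next
      fix x1 r1 x2 r2 assume "(x1, r1) \<in> \<Gamma>'" "(x2, r2) \<in> \<Gamma>'"
      then obtain y1 b1 y2 b2 where
        1: "x1 = y1 \<oplus>\<^bsub>M\<^esub> b1 \<odot>\<^bsub>M\<^esub> v" "(y1, r1) \<in> \<Gamma>" "b1 \<in> carrier R" and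
        2: "x2 = y2 \<oplus>\<^bsub>M\<^esub> b2 \<odot>\<^bsub>M\<^esub> v" "(y2, r2) \<in> \<Gamma>" "b2 \<in> carrier R"
        unfolding \<Gamma>'_def by blast
      have "x1 \<oplus>\<^bsub>M\<^esub> x2 = (y1 \<oplus>\<^bsub>M\<^esub> y2) \<oplus>\<^bsub>M\<^esub> (b1 \<oplus> b2) \<odot>\<^bsub>M\<^esub> v"
        using 1 2 \<Gamma>D(1)[OF 1(2)] \<Gamma>D(1)[OF 2(2)] v by (simp add: smult_l_distr M.a_ac)
      then show "(x1 \<oplus>\<^bsub>M\<^esub> x2, r1 \<oplus> r2) \<in> \<Gamma>'"
        using in\<Gamma>'[OF \<Gamma>D(4)[OF 1(2) 2(2)], of "b1 \<oplus> b2"] 1 2 by simp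
    next
      fix x1 r1 d assume d: "d \<in> carrier R" and "(x1, r1) \<in> \<Gamma>'"
      then obtain y1 b1 where
        1: "x1 = y1 \<oplus>\<^bsub>M\<^esub> b1 \<odot>\<^bsub>M\<^esub> v" "(y1, r1) \<in> \<Gamma>" "b1 \<in> carrier R"
        unfolding \<Gamma>'_def by blast
      have "d \<odot>\<^bsub>M\<^esub> x1 = (d \<odot>\<^bsub>M\<^esub> y1) \<oplus>\<^bsub>M\<^esub> (d \<otimes> b1) \<odot>\<^bsub>M\<^esub> v"
        using 1 \<Gamma>D(1)[OF 1(2)] v d by (simp add: smult_r_distr smult_assoc1)
      then show "(d \<odot>\<^bsub>M\<^esub> x1, d \<otimes> r1) \<in> \<Gamma>'"
        using in\<Gamma>'[OF \<Gamma>D(5)[OF d 1(2)], of "d \<otimes> b1"] 1 d by simp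
    next
      fix r assume "(\<zero>\<^bsub>M\<^esub>, r) \<in> \<Gamma>'"
      then obtain y b where
        1: "\<zero>\<^bsub>M\<^esub> = y \<oplus>\<^bsub>M\<^esub> b \<odot>\<^bsub>M\<^esub> v" "(y, r) \<in> \<Gamma>" "b \<in> carrier R"
        unfolding \<Gamma>'_def by blast
      have yc: "y \<in> carrier M" "r \<in> carrier R" using \<Gamma>D(1,2) 1(2) by auto
      have "b \<odot>\<^bsub>M\<^esub> v = \<ominus>\<^bsub>M\<^esub> y"
        using 1 yc v by (metis M.add.inv_equality M.add.inv_inv M.a_comm smult_closed)
      then have "b \<odot>\<^bsub>M\<^esub> v \<in> Domain \<Gamma>" using partial_functional_minus[OF \<Gamma> 1(2)] by auto
      then have "b \<in> P" using False 1(3) by blast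
      then have "(b \<odot>\<^bsub>M\<^esub> v, \<zero>) \<in> \<Gamma>" using PL v \<Gamma>D(3) by blast
      then have "(y \<oplus>\<^bsub>M\<^esub> b \<odot>\<^bsub>M\<^esub> v, r \<oplus> \<zero>) \<in> \<Gamma>" by (rule \<Gamma>D(4)[OF 1(2)])
      then show "r \<in> P" using \<Gamma>D(6) yc by (simp flip: 1(1))
    qed
    moreover have "v \<in> Domain \<Gamma>'"
      using in\<Gamma>'[OF zero R.one_closed] v by auto
    moreover have "\<exists>a\<in>carrier R - P. (x, a \<otimes> r) \<in> \<Gamma>'" if "(x, r) \<in> \<Gamma>" for x r
      using old[OF that] \<Gamma>D(2)[OF that] onP by (intro bexI[of _ \<one>]) auto
    ultimately show ?thesis by blast
  qed
qed

text \<open>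
  A vector that is not torsion modulo \<open>L\<close> is detected by a functional.  The functional
  \<open>l + a \<odot> c \<mapsto> a\<close> is extended over the generators one at a time.
\<close>

lemma exists_functional_nonzero_at:
  assumes P: "primeideal P R" and L: "submodule L R M"
    and PL: "\<And>a x. a \<in> P \<Longrightarrow> x \<in> carrier M \<Longrightarrow> a \<odot>\<^bsub>M\<^esub> x \<in> L"
    and c: "c \<in> carrier M" "\<And>a. a \<in> carrier R \<Longrightarrow> a \<odot>\<^bsub>M\<^esub> c \<in> L \<Longrightarrow> a \<in> P"
    and G: "finite G" "G \<subseteq> carrier M"
      "\<And>W. submodule W R M \<Longrightarrow> L \<subseteq> W \<Longrightarrow> G \<subseteq> W \<Longrightarrow> W = carrier M"
  shows "\<exists>\<theta>\<in>carrier M \<rightarrow> carrier R. \<theta> c \<notin> P \<and>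
     (\<forall>x\<in>carrier M. \<forall>y\<in>carrier M. \<theta> (x \<oplus>\<^bsub>M\<^esub> y) \<ominus> (\<theta> x \<oplus> \<theta> y) \<in> P) \<and>
     (\<forall>r\<in>carrier R. \<forall>x\<in>carrier M. \<theta> (r \<odot>\<^bsub>M\<^esub> x) \<ominus> r \<otimes> \<theta> x \<in> P)"
proof -
  interpret P: primeideal P R by fact
  note LE = submoduleE[OF L]
  have L0: "\<zero>\<^bsub>M\<^esub> \<in> L" using submodule.axioms(1)[OF L] subgroup.one_closed by fastforce
  have onP: "\<one> \<notin> P" using P.one_imp_carrier P.I_notcarr by auto
  define \<Gamma>0 where "\<Gamma>0 = {(l \<oplus>\<^bsub>M\<^esub> a \<odot>\<^bsub>M\<^esub> c, a) | l a. l \<in> L \<and> a \<in> carrier R}"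
  have in\<Gamma>0: "(l \<oplus>\<^bsub>M\<^esub> a \<odot>\<^bsub>M\<^esub> c, a) \<in> \<Gamma>0" if "l \<in> L" "a \<in> carrier R" for l a
    unfolding \<Gamma>0_def using that by blast
  have "partial_functional L P \<Gamma>0"
  proof (rule partial_functionalI)
    fix x r assume "(x, r) \<in> \<Gamma>0"
    then show "x \<in> carrier M \<and> r \<in> carrier R" unfolding \<Gamma>0_def using LE(1) c by auto
  next
    fix l assume "l \<in> L"
    then show "(l, \<zero>) \<in> \<Gamma>0" using in\<Gamma>0[of l \<zero>] LE(1) c by auto
  next
    fix x1 r1 x2 r2 assume "(x1, r1) \<in> \<Gamma>0" "(x2, r2) \<in> \<Gamma>0"
    then obtain l1 l2 where 1: "x1 = l1 \<oplus>\<^bsub>M\<^esub> r1 \<odot>\<^bsub>M\<^esub> c" "l1 \<in> L" "r1 \<in> carrier R"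
      and 2: "x2 = l2 \<oplus>\<^bsub>M\<^esub> r2 \<odot>\<^bsub>M\<^esub> c" "l2 \<in> L" "r2 \<in> carrier R"
      unfolding \<Gamma>0_def by blast
    have "l1 \<in> carrier M" "l2 \<in> carrier M" using 1 2 LE(1) by auto
    then have "x1 \<oplus>\<^bsub>M\<^esub> x2 = (l1 \<oplus>\<^bsub>M\<^esub> l2) \<oplus>\<^bsub>M\<^esub> (r1 \<oplus> r2) \<odot>\<^bsub>M\<^esub> c"
      using 1 2 c by (simp add: smult_l_distr M.a_ac)
    then show "(x1 \<oplus>\<^bsub>M\<^esub> x2, r1 \<oplus> r2) \<in> \<Gamma>0"
      using in\<Gamma>0[OF LE(5)[OF 1(2) 2(2)], of "r1 \<oplus> r2"] 1 2 by simp
  next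
    fix x r a assume a: "a \<in> carrier R" and "(x, r) \<in> \<Gamma>0"
    then obtain l where 1: "x = l \<oplus>\<^bsub>M\<^esub> r \<odot>\<^bsub>M\<^esub> c" "l \<in> L" "r \<in> carrier R"
      unfolding \<Gamma>0_def by blast
    have "l \<in> carrier M" using 1 LE(1) by auto
    then have "a \<odot>\<^bsub>M\<^esub> x = a \<odot>\<^bsub>M\<^esub> l \<oplus>\<^bsub>M\<^esub> (a \<otimes> r) \<odot>\<^bsub>M\<^esub> c"
      using 1 c a by (simp add: smult_r_distr smult_assoc1)
    then show "(a \<odot>\<^bsub>M\<^esub> x, a \<otimes> r) \<in> \<Gamma>0"
      using in\<Gamma>0[OF LE(4)[OF a 1(2)], of "a \<otimes> r"] 1 a by simp
  next
    fix r assume "(\<zero>\<^bsub>M\<^esub>, r) \<in> \<Gamma>0"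
    then obtain l where 1: "\<zero>\<^bsub>M\<^esub> = l \<oplus>\<^bsub>M\<^esub> r \<odot>\<^bsub>M\<^esub> c" "l \<in> L" "r \<in> carrier R"
      unfolding \<Gamma>0_def by blast
    have "l \<in> carrier M" using 1 LE(1) by auto
    then have "r \<odot>\<^bsub>M\<^esub> c = \<ominus>\<^bsub>M\<^esub> l"
      using 1 c by (metis M.add.inv_equality M.add.inv_inv M.a_comm smult_closed)
    then show "r \<in> P" using LE(3)[OF 1(2)] c(2) 1(3) by simp
  qed
  moreover have "(c, \<one>) \<in> \<Gamma>0" using in\<Gamma>0[OF L0 R.one_closed] c by simp
  ultimately have start: "\<exists>\<Gamma> s. partial_functional L P \<Gamma> \<and> {} \<subseteq> Domain \<Gamma> \<and> (c, s) \<in> \<Gamma> \<and> s \<notin> P"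
    using onP by blast
  have "\<exists>\<Gamma> s. partial_functional L P \<Gamma> \<and> G \<subseteq> Domain \<Gamma> \<and> (c, s) \<in> \<Gamma> \<and> s \<notin> P"
    using G(1,2)
  proof (induction)
    case empty
    show ?case by (rule start)
  next
    case (insert v G)
    then obtain \<Gamma> s where \<Gamma>: "partial_functional L P \<Gamma>" "G \<subseteq> Domain \<Gamma>" "(c, s) \<in> \<Gamma>" "s \<notin> P"
      by auto
    obtain \<Gamma>' where \<Gamma>': "partial_functional L P \<Gamma>'" "v \<in> Domain \<Gamma>'"
        "\<And>x r. (x, r) \<in> \<Gamma> \<Longrightarrow> \<exists>a\<in>carrier R - P. (x, a \<otimes> r) \<in> \<Gamma>'"
      using partial_functional_extend[OF P PL \<Gamma>(1) _ L0, of v] insert.prems by blast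
    obtain a where a: "a \<in> carrier R" "a \<notin> P" "(c, a \<otimes> s) \<in> \<Gamma>'" using \<Gamma>'(3)[OF \<Gamma>(3)] by blast
    have "a \<otimes> s \<notin> P" using P.I_prime[of a s] a \<Gamma>(4) partial_functionalD(2)[OF \<Gamma>(1,3)] by blast
    moreover have "insert v G \<subseteq> Domain \<Gamma>'" using \<Gamma>(2) \<Gamma>'(2,3) by blast
    ultimately show ?case using \<Gamma>'(1) a(3) by blast
  qed
  then obtain \<Gamma> s where \<Gamma>: "partial_functional L P \<Gamma>" "G \<subseteq> Domain \<Gamma>" "(c, s) \<in> \<Gamma>" "s \<notin> P"
    by blast
  note \<Gamma>D = partial_functionalD[OF \<Gamma>(1)]
  have "submodule (Domain \<Gamma>) R M"
  proof (rule submoduleI)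
    show "Domain \<Gamma> \<subseteq> carrier M" using \<Gamma>D(1) by (auto elim!: DomainE)
    show "\<zero>\<^bsub>M\<^esub> \<in> Domain \<Gamma>" by (rule DomainI[OF \<Gamma>D(3)[OF L0]])
    show "\<ominus>\<^bsub>M\<^esub> x \<in> Domain \<Gamma>" if "x \<in> Domain \<Gamma>" for x
      using that by (elim DomainE) (rule DomainI[OF partial_functional_minus[OF \<Gamma>(1)]])
    show "x \<oplus>\<^bsub>M\<^esub> y \<in> Domain \<Gamma>" if "x \<in> Domain \<Gamma>" "y \<in> Domain \<Gamma>" for x y
      using that by (elim DomainE) (rule DomainI[OF \<Gamma>D(4)])
    show "a \<odot>\<^bsub>M\<^esub> x \<in> Domain \<Gamma>" if "a \<in> carrier R" "x \<in> Domain \<Gamma>" for a x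
      using that(2) by (elim DomainE) (rule DomainI[OF \<Gamma>D(5)[OF that(1)]])
  qed
  moreover have "L \<subseteq> Domain \<Gamma>" using DomainI[OF \<Gamma>D(3)] by (rule subsetI)
  ultimately have dom: "Domain \<Gamma> = carrier M" using \<Gamma>(2) by (intro G(3))
  define \<theta> where "\<theta> x = (SOME r. (x, r) \<in> \<Gamma>)" for x
  have \<theta>: "(x, \<theta> x) \<in> \<Gamma>" if "x \<in> carrier M" for x
    using that[folded dom] unfolding \<theta>_def by (elim DomainE) (rule someI)
  note cong = partial_functional_cong[OF \<Gamma>(1)]
  show ?thesis
  proof (intro bexI[of _ \<theta>] conjI ballI)
    show "\<theta> \<in> carrier M \<rightarrow> carrier R" using \<theta> \<Gamma>D(2) by blast
    show "\<theta> c \<notin> P"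
    proof
      assume "\<theta> c \<in> P"
      moreover have "s \<ominus> \<theta> c \<in> P" using cong[OF \<Gamma>(3) \<theta>[OF c(1)]] .
      moreover have "s = (s \<ominus> \<theta> c) \<oplus> \<theta> c" using \<Gamma>D(2) \<Gamma>(3) \<theta>[OF c(1)] by algebra
      ultimately show False using \<Gamma>(4) P.a_closed by metis
    qed
    show "\<theta> (x \<oplus>\<^bsub>M\<^esub> y) \<ominus> (\<theta> x \<oplus> \<theta> y) \<in> P" if "x \<in> carrier M" "y \<in> carrier M" for x y
      using cong[OF \<theta> \<Gamma>D(4)[OF \<theta> \<theta>]] that by simp
    show "\<theta> (r \<odot>\<^bsub>M\<^esub> x) \<ominus> r \<otimes> \<theta> x \<in> P" if "r \<in> carrier R" "x \<in> carrier M" for r x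
      using cong[OF \<theta> \<Gamma>D(5)[OF _ \<theta>]] that by simp
  qed
qed

end

section \<open>Finiteness of the iterated Frobenius\<close>

context prime_char_ring
begin

abbreviation frob :: "nat \<Rightarrow> ('a, 'a) module" where
  "frob e \<equiv> frob_module p e R (regular_module R)"

lemma frob_simps:
  "carrier (frob e) = carrier R" "x \<oplus>\<^bsub>frob e\<^esub> y = x \<oplus> y" "\<zero>\<^bsub>frob e\<^esub> = \<zero>"
  "r \<odot>\<^bsub>frob e\<^esub> x = r [^] (p ^ e) \<otimes> x"
  by (simp_all add: frob_module_def restrict_scalars_def regular_module_def)

lemma module_frob: "module R (frob e)"
proof (rule moduleI)
  show "abelian_group (frob e)"
    by (rule abelian_groupI) (auto simp: frob_simps a_ac intro: l_neg)
qed (auto simp: frob_simps is_cring frobenius_pow_add nat_pow_distrib l_distr r_distr m_assoc)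

lemma submodule_frobI:
  assumes "W \<subseteq> carrier R" "\<zero> \<in> W" "\<And>x y. x \<in> W \<Longrightarrow> y \<in> W \<Longrightarrow> x \<oplus> y \<in> W"
    and smult: "\<And>r x. r \<in> carrier R \<Longrightarrow> x \<in> W \<Longrightarrow> r [^] (p ^ e) \<otimes> x \<in> W"
  shows "submodule W R (frob e)"
proof -
  interpret F: module R "frob e" by (rule module_frob)
  show ?thesis
  proof (rule F.submoduleI)
    fix x assume x: "x \<in> W"
    then have "\<ominus>\<^bsub>frob e\<^esub> x = (\<ominus> \<one>) \<odot>\<^bsub>frob e\<^esub> x"
      using assms(1) F.smult_l_minus[of \<one> x] F.smult_one[of x] by (auto simp: frob_simps(1))
    then show "\<ominus>\<^bsub>frob e\<^esub> x \<in> W" using smult[OF _ x, of "\<ominus> \<one>"] by (simp add: frob_simps)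
  qed (use assms in \<open>auto simp: frob_simps\<close>)
qed

lemma submodule_frobD:
  assumes "submodule W R (frob e)"
  shows "W \<subseteq> carrier R" "\<zero> \<in> W" "x \<in> W \<Longrightarrow> y \<in> W \<Longrightarrow> x \<oplus> y \<in> W"
    "r \<in> carrier R \<Longrightarrow> x \<in> W \<Longrightarrow> r [^] (p ^ e) \<otimes> x \<in> W"
proof -
  interpret F: module R "frob e" by (rule module_frob)
  note E = F.submoduleE[OF assms]
  show "W \<subseteq> carrier R" using E(1) by (simp add: frob_simps)
  show "\<zero> \<in> W" using subgroup.one_closed[OF submodule.axioms(1)[OF assms]] by (simp add: frob_simps)
  show "x \<in> W \<Longrightarrow> y \<in> W \<Longrightarrow> x \<oplus> y \<in> W" using E(5) by (simp add: frob_simps)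
  show "r \<in> carrier R \<Longrightarrow> x \<in> W \<Longrightarrow> r [^] (p ^ e) \<otimes> x \<in> W" using E(4) by (simp add: frob_simps)
qed

text \<open>In characteristic \<open>p\<close> a common Frobenius power kills both summands of a sum of nilpotents.\<close>

lemma ideal_nilradical: "ideal (nilradical R) R"
proof (rule idealI[OF ring_axioms])
  interpret Z: ideal "{\<zero>}" R by (rule zeroideal)
  have le: "n \<le> p ^ n" for n
    using less_exp[of n] power_mono[OF prime_ge_2_nat[OF prime_p], of n] by linarith
  have pow: "x [^] (p ^ k) = \<zero>" if "x \<in> carrier R" "x [^] n = \<zero>" "n \<le> k" for x and n k :: nat
    using Z.pow_mono[OF that(1), of n "p ^ k"] that le[of k] by auto
  show "subgroup (nilradical R) (add_monoid R)"
  proof (rule add.subgroupI)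
    have "\<zero> [^] (1::nat) = \<zero>" by simp
    then have "\<zero> \<in> nilradical R" unfolding nilradical_def by blast
    then show "nilradical R \<noteq> {}" by (metis empty_iff)
  next
    fix x assume "x \<in> nilradical R"
    then obtain n :: nat where x: "x \<in> carrier R" "x [^] n = \<zero>" by (auto simp: nilradical_def)
    then have "(\<ominus> x) [^] (p ^ n) = \<zero>" using pow[OF x] by (simp add: frobenius_pow_minus)
    moreover have "\<ominus> x \<in> carrier R" using x by simp
    ultimately show "\<ominus> x \<in> nilradical R" unfolding nilradical_def by blast
  next
    fix x y assume "x \<in> nilradical R" "y \<in> nilradical R"
    then obtain n m :: nat where x: "x \<in> carrier R" "x [^] n = \<zero>" and y: "y \<in> carrier R" "y [^] m = \<zero>"
      by (auto simp: nilradical_def)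
    then have "(x \<oplus> y) [^] (p ^ (n + m)) = \<zero>"
      using pow[OF x, of "n + m"] pow[OF y, of "n + m"] by (simp add: frobenius_pow_add)
    moreover have "x \<oplus> y \<in> carrier R" using x y by simp
    ultimately show "x \<oplus> y \<in> nilradical R" unfolding nilradical_def by blast
  qed (auto simp: nilradical_def)
next
  fix x r assume "x \<in> nilradical R" and r: "r \<in> carrier R"
  then obtain n :: nat where x: "x \<in> carrier R" "x [^] n = \<zero>" by (auto simp: nilradical_def)
  then have "(r \<otimes> x) [^] n = \<zero>" "(x \<otimes> r) [^] n = \<zero>" using r by (auto simp: nat_pow_distrib)
  moreover have "r \<otimes> x \<in> carrier R" "x \<otimes> r \<in> carrier R" using x r by auto
  ultimately show "r \<otimes> x \<in> nilradical R" "x \<otimes> r \<in> nilradical R"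
    unfolding nilradical_def by blast+
qed

text \<open>
  Finite generation of \<open>\<^sup>eR\<close> modulo the nilradical.  It is phrased through submodules rather than
  linear combinations, because the graph of a functional is extended one generator at a time and
  its domain is a submodule.
\<close>

definition finite_frob_mod_nilradical :: "nat \<Rightarrow> bool" where
  "finite_frob_mod_nilradical e \<longleftrightarrow> (\<exists>G. finite G \<and> G \<subseteq> carrier R \<and>
     (\<forall>W. submodule W R (frob e) \<longrightarrow> nilradical R \<subseteq> W \<longrightarrow> G \<subseteq> W \<longrightarrow> W = carrier R))"

text \<open>Representatives of the generators of the reduced ring generate up to nilpotents.\<close>

lemma F_finite_reduced_imp_finite_frob_1:
  assumes "F_finite p (reduced_ring R)"
  shows "finite_frob_mod_nilradical 1"
proof -
  define N where "N = nilradical R"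
  interpret N: ideal N R unfolding N_def by (rule ideal_nilradical)
  interpret Q: cring "R Quot N" by (rule N.quotient_is_cring[OF is_cring])
  interpret \<pi>: ring_hom_ring R "R Quot N" "(+>\<^bsub>R\<^esub>) N" by (rule N.rcos_ring_hom_ring)
  have car: "\<exists>x\<in>carrier R. X = N +> x" if "X \<in> carrier (R Quot N)" for X
    using that unfolding FactRing_simps by auto
  obtain G where G: "finite G" "G \<subseteq> carrier (R Quot N)"
    "\<forall>b\<in>carrier (R Quot N). \<exists>a\<in>G \<rightarrow> carrier (R Quot N).
        b = (\<Oplus>\<^bsub>R Quot N\<^esub>x\<in>G. (a x [^]\<^bsub>R Quot N\<^esub> p) \<otimes>\<^bsub>R Quot N\<^esub> x)"
    using assms[unfolded F_finite_def finite_ring_map_def reduced_ring_def, folded N_def]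
    by (elim conjE exE) (rule that)
  define \<rho> where "\<rho> X = (SOME x. x \<in> carrier R \<and> X = N +> x)" for X
  have \<rho>: "\<rho> X \<in> carrier R" "N +> \<rho> X = X" if "X \<in> carrier (R Quot N)" for X
  proof -
    have "\<rho> X \<in> carrier R \<and> X = N +> \<rho> X"
      unfolding \<rho>_def by (rule someI_ex) (use car[OF that] in blast)
    then show "\<rho> X \<in> carrier R" "N +> \<rho> X = X" by auto
  qed
  have "W = carrier R" if W: "submodule W R (frob 1)" "N \<subseteq> W" "\<rho> ` G \<subseteq> W" for W
  proof
    note WD = submodule_frobD[OF W(1)]
    show "W \<subseteq> carrier R" by (rule WD(1))
    have sum: "\<exists>w\<in>W. (\<Oplus>\<^bsub>R Quot N\<^esub>x\<in>F. (a x [^]\<^bsub>R Quot N\<^esub> p) \<otimes>\<^bsub>R Quot N\<^esub> x) = N +> w"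
      if "finite F" "F \<subseteq> G" "a \<in> G \<rightarrow> carrier (R Quot N)" for F a
      using that
    proof (induction F)
      case empty
      then show ?case using WD(2) \<pi>.hom_zero by (intro bexI[of _ \<zero>]) auto
    next
      case (insert x F)
      then obtain w where w: "w \<in> W"
          "(\<Oplus>\<^bsub>R Quot N\<^esub>x\<in>F. (a x [^]\<^bsub>R Quot N\<^esub> p) \<otimes>\<^bsub>R Quot N\<^esub> x) = N +> w" by auto
      have x: "x \<in> G" "x \<in> carrier (R Quot N)" and ax: "a x \<in> carrier (R Quot N)"
        using insert.prems G(2) by auto
      have xW: "\<rho> x \<in> W" using x W(3) by auto
      define v where "v = \<rho> (a x) [^] p \<otimes> \<rho> x"
      have vW: "v \<in> W" unfolding v_def using WD(4)[OF \<rho>(1)[OF ax] xW] by simp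
      have vc: "v \<in> carrier R" "w \<in> carrier R" using vW w WD(1) by auto
      have "(a x [^]\<^bsub>R Quot N\<^esub> p) \<otimes>\<^bsub>R Quot N\<^esub> x = N +> v"
        unfolding v_def using \<rho>[OF ax] \<rho>[OF x(2)] by (simp add: \<pi>.hom_nat_pow)
      then have "(\<Oplus>\<^bsub>R Quot N\<^esub>x\<in>insert x F. (a x [^]\<^bsub>R Quot N\<^esub> p) \<otimes>\<^bsub>R Quot N\<^esub> x)
          = (N +> v) \<oplus>\<^bsub>R Quot N\<^esub> (N +> w)"
        using insert.hyps insert.prems G(2) ax x w(2) \<pi>.hom_closed[OF vc(1)]
        by (subst Q.finsum_insert) (auto simp: Pi_def subset_iff)
      also have "\<dots> = N +> (v \<oplus> w)" using vc by simp
      finally show ?case using WD(3)[OF vW w(1)] by blast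
    qed
    show "carrier R \<subseteq> W"
    proof
      fix r assume r: "r \<in> carrier R"
      then obtain a where a: "a \<in> G \<rightarrow> carrier (R Quot N)"
          "N +> r = (\<Oplus>\<^bsub>R Quot N\<^esub>x\<in>G. (a x [^]\<^bsub>R Quot N\<^esub> p) \<otimes>\<^bsub>R Quot N\<^esub> x)"
        using bspec[OF G(3) \<pi>.hom_closed[OF r]] by blast
      obtain w where w: "w \<in> W" "N +> r = N +> w" using sum[OF G(1) subset_refl a(1)] a(2) by auto
      have wc: "w \<in> carrier R" using w WD(1) by blast
      have "r \<ominus> w \<in> N" using quotient_eq_iff_same_a_r_cos[OF N.is_ideal r wc] w(2) by simp
      then have "r \<ominus> w \<in> W" using W(2) by blast
      then have "(r \<ominus> w) \<oplus> w \<in> W" using WD(3) w(1) by blast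
      moreover have "(r \<ominus> w) \<oplus> w = r" using r wc by algebra
      ultimately show "r \<in> W" by simp
    qed
  qed
  then show ?thesis
    unfolding finite_frob_mod_nilradical_def N_def[symmetric]
    using G(1,2) \<rho>(1) by (intro exI[of _ "\<rho> ` G"]) auto
qed

text \<open>
  If \<open>g\<^sub>i\<close> generate over \<open>p\<close>-th powers and \<open>h\<^sub>j\<close> over \<open>p\<^sup>e\<close>-th powers, then the products
  \<open>h\<^sub>j\<^sup>p g\<^sub>i\<close> generate over \<open>p\<^sup>e\<^sup>+\<^sup>1\<close>-th powers.
\<close>

lemma finite_frob_all_exponents:
  assumes one: "finite_frob_mod_nilradical 1"
  shows "finite_frob_mod_nilradical e"
proof (induction e)
  case 0
  have "W = carrier R" if "submodule W R (frob 0)" "\<one> \<in> W" for W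
  proof
    note WD = submodule_frobD[OF that(1)]
    show "W \<subseteq> carrier R" by (rule WD(1))
    show "carrier R \<subseteq> W" using WD(4)[OF _ that(2)] by auto
  qed
  then show ?case
    unfolding finite_frob_mod_nilradical_def by (intro exI[of _ "{\<one>}"]) auto
next
  case (Suc e)
  interpret N: ideal "nilradical R" R by (rule ideal_nilradical)
  obtain G where G: "finite G" "G \<subseteq> carrier R"
    "\<And>W. submodule W R (frob 1) \<Longrightarrow> nilradical R \<subseteq> W \<Longrightarrow> G \<subseteq> W \<Longrightarrow> W = carrier R"
    using one unfolding finite_frob_mod_nilradical_def by blast
  obtain H where H: "finite H" "H \<subseteq> carrier R"
    "\<And>W. submodule W R (frob e) \<Longrightarrow> nilradical R \<subseteq> W \<Longrightarrow> H \<subseteq> W \<Longrightarrow> W = carrier R"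
    using Suc unfolding finite_frob_mod_nilradical_def by blast
  define K where "K = (\<lambda>(h, g). h [^] p \<otimes> g) ` (H \<times> G)"
  have "W = carrier R" if W: "submodule W R (frob (Suc e))" "nilradical R \<subseteq> W" "K \<subseteq> W" for W
  proof
    note WD = submodule_frobD[OF W(1)]
    show "W \<subseteq> carrier R" by (rule WD(1))
    have powp: "(r [^] (p ^ e)) [^] p = r [^] (p ^ Suc e)" if "r \<in> carrier R" for r
      using pow_p_Suc[OF that] by simp
    have nil: "x [^] p \<otimes> y \<in> W"
      if "x \<in> carrier R" "y \<in> carrier R" "x \<in> nilradical R \<or> y \<in> nilradical R" for x y
    proof -
      have "1 \<le> p" using prime_p by (rule prime_ge_1_nat)
      then have "x [^] p \<in> nilradical R \<or> y \<in> nilradical R"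
        using N.pow_mono[OF that(1), of 1 p] that(1,3) by auto
      then have "x [^] p \<otimes> y \<in> nilradical R"
        using N.I_l_closed[of y "x [^] p"] N.I_r_closed[of "x [^] p" y] that(1,2) by auto
      then show ?thesis using W(2) by blast
    qed
    have g: "x [^] p \<otimes> g \<in> W" if x: "x \<in> carrier R" and g: "g \<in> G" for x g
    proof -
      have gc: "g \<in> carrier R" using g G by blast
      have "submodule {x \<in> carrier R. x [^] p \<otimes> g \<in> W} R (frob e)"
      proof (rule submodule_frobI)
        show "\<zero> \<in> {x \<in> carrier R. x [^] p \<otimes> g \<in> W}"
          using WD(2) gc zero_pow_p[of 1] by simp
      next
        fix x y assume "x \<in> {x \<in> carrier R. x [^] p \<otimes> g \<in> W}" "y \<in> {x \<in> carrier R. x [^] p \<otimes> g \<in> W}"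
        then show "x \<oplus> y \<in> {x \<in> carrier R. x [^] p \<otimes> g \<in> W}"
          using WD(3) gc by (auto simp: frobenius_add l_distr)
      next
        fix r x assume r: "r \<in> carrier R" and x: "x \<in> {x \<in> carrier R. x [^] p \<otimes> g \<in> W}"
        have "(r [^] (p ^ e) \<otimes> x) [^] p \<otimes> g = r [^] (p ^ Suc e) \<otimes> (x [^] p \<otimes> g)"
          using r x gc by (simp only: nat_pow_distrib powp nat_pow_closed m_assoc mem_Collect_eq)
        then show "r [^] (p ^ e) \<otimes> x \<in> {x \<in> carrier R. x [^] p \<otimes> g \<in> W}"
          using WD(4)[OF r, of "x [^] p \<otimes> g"] r x by auto
      qed auto
      moreover have "nilradical R \<subseteq> {x \<in> carrier R. x [^] p \<otimes> g \<in> W}"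
        using nil gc N.Icarr by blast
      moreover have "H \<subseteq> {x \<in> carrier R. x [^] p \<otimes> g \<in> W}"
        using H(2) W(3) g unfolding K_def by force
      ultimately show ?thesis using H(3) x by blast
    qed
    have "submodule {y \<in> carrier R. \<forall>x\<in>carrier R. x [^] p \<otimes> y \<in> W} R (frob 1)"
    proof (rule submodule_frobI)
      show "\<zero> \<in> {y \<in> carrier R. \<forall>x\<in>carrier R. x [^] p \<otimes> y \<in> W}" using WD(2) by simp
    next
      fix y z assume "y \<in> {y \<in> carrier R. \<forall>x\<in>carrier R. x [^] p \<otimes> y \<in> W}"
        "z \<in> {y \<in> carrier R. \<forall>x\<in>carrier R. x [^] p \<otimes> y \<in> W}"
      then show "y \<oplus> z \<in> {y \<in> carrier R. \<forall>x\<in>carrier R. x [^] p \<otimes> y \<in> W}"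
        using WD(3) by (auto simp: r_distr)
    next
      fix r y assume r: "r \<in> carrier R" and y: "y \<in> {y \<in> carrier R. \<forall>x\<in>carrier R. x [^] p \<otimes> y \<in> W}"
      have "x [^] p \<otimes> (r [^] p \<otimes> y) = (x \<otimes> r) [^] p \<otimes> y" if "x \<in> carrier R" for x
        using that r y by (simp add: nat_pow_distrib m_assoc)
      then show "r [^] (p ^ 1) \<otimes> y \<in> {y \<in> carrier R. \<forall>x\<in>carrier R. x [^] p \<otimes> y \<in> W}"
        using r y by simp
    qed auto
    moreover have "nilradical R \<subseteq> {y \<in> carrier R. \<forall>x\<in>carrier R. x [^] p \<otimes> y \<in> W}"
      using nil N.Icarr by blast
    moreover have "G \<subseteq> {y \<in> carrier R. \<forall>x\<in>carrier R. x [^] p \<otimes> y \<in> W}"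
      using g G(2) by blast
    ultimately have all: "{y \<in> carrier R. \<forall>x\<in>carrier R. x [^] p \<otimes> y \<in> W} = carrier R"
      by (rule G(3))
    show "carrier R \<subseteq> W"
    proof
      fix y assume y: "y \<in> carrier R"
      then have "\<one> [^] p \<otimes> y \<in> W" using all one_closed by blast
      then show "y \<in> W" using y by simp
    qed
  qed
  moreover have "finite K" unfolding K_def using G(1) H(1) by simp
  moreover have "K \<subseteq> carrier R"
    unfolding K_def using subsetD[OF G(2)] subsetD[OF H(2)] by (auto intro!: m_closed nat_pow_closed)
  ultimately show ?case unfolding finite_frob_mod_nilradical_def by (intro exI[of _ K]) blast
qed

end

text \<open>
  Locally at \<open>P\<close>, the element \<open>c\<close> lies outside an ideal \<open>L\<close> containing the \<open>p\<^sup>e\<close>-th powers of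
  \<open>P\<close>, so \<open>c\<close> is not torsion in the finite \<open>R / P\<close>-module \<open>\<^sup>eR / L\<close> and is detected by a
  functional.  As \<open>L\<close> contains the prime \<open>P\<^sub>0\<close> and with it the nilradical, generators modulo the
  nilradical suffice.
\<close>

lemma (in noetherian_prime_char_ring) exists_frob_functional:
  assumes F: "F_finite p (reduced_ring R)"
    and P0: "primeideal P\<^sub>0 R" and P: "primeideal P R" and sub: "P\<^sub>0 \<subseteq> P"
    and c: "c \<in> carrier R" "c \<notin> P\<^sub>0"
  shows "\<exists>e\<^sub>0. \<forall>e\<ge>e\<^sub>0. \<exists>\<theta>\<in>carrier R \<rightarrow> carrier R. \<theta> c \<notin> P \<and>
     (\<forall>x\<in>carrier R. \<forall>y\<in>carrier R. \<theta> (x \<oplus> y) \<ominus> (\<theta> x \<oplus> \<theta> y) \<in> P) \<and>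
     (\<forall>r\<in>carrier R. \<forall>x\<in>carrier R. \<theta> (r [^] (p ^ e) \<otimes> x) \<ominus> r \<otimes> \<theta> x \<in> P)"
proof -
  interpret P0: primeideal P\<^sub>0 R by fact
  interpret P: primeideal P R by fact
  obtain L e\<^sub>0 where L: "ideal L R" "P\<^sub>0 \<subseteq> L" "\<And>s. s \<in> carrier R \<Longrightarrow> s \<otimes> c \<in> L \<Longrightarrow> s \<in> P"
      "\<And>x. x \<in> P \<Longrightarrow> x [^] (p ^ e\<^sub>0) \<in> L"
    using obtain_ideal_avoiding_element[OF P0 P sub c] by blast
  interpret L: ideal L R by (rule L(1))
  have "nilradical R \<subseteq> P\<^sub>0"
  proof
    fix x assume "x \<in> nilradical R"
    then obtain n :: nat where "x \<in> carrier R" "x [^] n = \<zero>" by (auto simp: nilradical_def)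
    then show "x \<in> P\<^sub>0" using P0.pow_in_imp_in[of x n] P0.zero_closed by simp
  qed
  then have nil: "nilradical R \<subseteq> L" using L(2) by blast
  show ?thesis
  proof (intro exI[of _ e\<^sub>0] allI impI)
    fix e assume e: "e\<^sub>0 \<le> e"
    interpret F: module R "frob e" by (rule module_frob)
    obtain G where G: "finite G" "G \<subseteq> carrier R"
      "\<And>W. submodule W R (frob e) \<Longrightarrow> nilradical R \<subseteq> W \<Longrightarrow> G \<subseteq> W \<Longrightarrow> W = carrier R"
      using finite_frob_all_exponents[OF F_finite_reduced_imp_finite_frob_1[OF F], of e]
      unfolding finite_frob_mod_nilradical_def by blast
    have subL: "submodule L R (frob e)"
      by (rule submodule_frobI) (use L.Icarr L.I_l_closed in auto)
    have PL: "a [^] (p ^ e) \<otimes> x \<in> L" if "a \<in> P" "x \<in> carrier R" for a x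
    proof -
      have "p ^ e\<^sub>0 \<le> p ^ e" using e prime_ge_1_nat[OF prime_p] by (rule power_increasing)
      then show ?thesis
        using L.pow_mono[OF P.Icarr[OF that(1)] L(4)[OF that(1)]] that(2) L.I_r_closed by blast
    qed
    have tor: "a \<in> P" if "a \<in> carrier R" "a [^] (p ^ e) \<otimes> c \<in> L" for a
      using L(3)[OF _ that(2)] that(1) P.pow_in_imp_in[OF that(1)] by blast
    have gen: "W = carrier R" if "submodule W R (frob e)" "L \<subseteq> W" "G \<subseteq> W" for W
      using G(3)[OF that(1) _ that(3)] nil that(2) by (meson subset_trans)
    show "\<exists>\<theta>\<in>carrier R \<rightarrow> carrier R. \<theta> c \<notin> P \<and>
     (\<forall>x\<in>carrier R. \<forall>y\<in>carrier R. \<theta> (x \<oplus> y) \<ominus> (\<theta> x \<oplus> \<theta> y) \<in> P) \<and>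
     (\<forall>r\<in>carrier R. \<forall>x\<in>carrier R. \<theta> (r [^] (p ^ e) \<otimes> x) \<ominus> r \<otimes> \<theta> x \<in> P)"
      by (rule F.exists_functional_nonzero_at[OF P subL, unfolded frob_simps, OF PL c(1) tor G(1,2) gen])
  qed
qed

section \<open>Semilinear maps into another ring\<close>

locale prime_char_ring_hom =
  R?: noetherian_prime_char_ring R p + S?: noetherian_prime_char_ring S p
  for R (structure) and S (structure) and p +
  fixes j
  assumes j: "j \<in> ring_hom R S"
begin

sublocale j: ring_hom_cring R S j
  by unfold_locales (rule j)

text \<open>The \<open>R\<close>-linear maps \<open>\<^sup>eR \<rightarrow> \<^sup>kS\<close>.\<close>

definition semilinear_maps where
  "semilinear_maps e k = {\<theta> \<in> carrier R \<rightarrow> carrier S.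
     (\<forall>x\<in>carrier R. \<forall>y\<in>carrier R. \<theta> (x \<oplus>\<^bsub>R\<^esub> y) = \<theta> x \<oplus>\<^bsub>S\<^esub> \<theta> y) \<and>
     (\<forall>r\<in>carrier R. \<forall>x\<in>carrier R.
        \<theta> (r [^]\<^bsub>R\<^esub> (p ^ e) \<otimes>\<^bsub>R\<^esub> x) = j r [^]\<^bsub>S\<^esub> (p ^ k) \<otimes>\<^bsub>S\<^esub> \<theta> x)}"

lemma semilinear_mapsD:
  assumes "\<theta> \<in> semilinear_maps e k"
  shows "x \<in> carrier R \<Longrightarrow> \<theta> x \<in> carrier S"
    and "x \<in> carrier R \<Longrightarrow> y \<in> carrier R \<Longrightarrow> \<theta> (x \<oplus>\<^bsub>R\<^esub> y) = \<theta> x \<oplus>\<^bsub>S\<^esub> \<theta> y"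
    and "r \<in> carrier R \<Longrightarrow> x \<in> carrier R \<Longrightarrow>
      \<theta> (r [^]\<^bsub>R\<^esub> (p ^ e) \<otimes>\<^bsub>R\<^esub> x) = j r [^]\<^bsub>S\<^esub> (p ^ k) \<otimes>\<^bsub>S\<^esub> \<theta> x"
  using assms unfolding semilinear_maps_def by auto

text \<open>\<open>S\<close> acts on the semilinear maps through multiplication of values.\<close>

lemma semilinear_values_ideal:
  assumes c: "c \<in> carrier R"
  shows "ideal ((\<lambda>\<theta>. \<theta> c) ` semilinear_maps e k) S"
proof -
  let ?V = "(\<lambda>\<theta>. \<theta> c) ` semilinear_maps e k"
  have mult: "(\<lambda>x. s \<otimes>\<^bsub>S\<^esub> \<theta> x) \<in> semilinear_maps e k"
    if s: "s \<in> carrier S" and \<theta>: "\<theta> \<in> semilinear_maps e k" for s \<theta>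
    using s semilinear_mapsD[OF \<theta>]
    by (auto simp: semilinear_maps_def S.r_distr S.m_lcomm)
  have add: "(\<lambda>x. \<theta> x \<oplus>\<^bsub>S\<^esub> \<eta> x) \<in> semilinear_maps e k"
    if \<theta>: "\<theta> \<in> semilinear_maps e k" and \<eta>: "\<eta> \<in> semilinear_maps e k" for \<theta> \<eta>
    using semilinear_mapsD[OF \<theta>] semilinear_mapsD[OF \<eta>]
    by (auto simp: semilinear_maps_def S.r_distr S.a_ac)
  have smult: "s \<otimes>\<^bsub>S\<^esub> v \<in> ?V" if "s \<in> carrier S" "v \<in> ?V" for s v
    using that mult by auto
  have sub: "?V \<subseteq> carrier S" using c semilinear_mapsD(1) by auto
  show ?thesis
  proof (rule idealI[OF S.ring_axioms])
    show "subgroup ?V (add_monoid S)"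
    proof (rule S.add.subgroupI[OF sub])
      have "(\<lambda>x. \<zero>\<^bsub>S\<^esub>) \<in> semilinear_maps e k" by (auto simp: semilinear_maps_def)
      then show "?V \<noteq> {}" by blast
      show "\<ominus>\<^bsub>S\<^esub> v \<in> ?V" if "v \<in> ?V" for v
      proof -
        have "(\<ominus>\<^bsub>S\<^esub> \<one>\<^bsub>S\<^esub>) \<otimes>\<^bsub>S\<^esub> v = \<ominus>\<^bsub>S\<^esub> v" using subsetD[OF sub that] by (simp add: S.l_minus)
        then show ?thesis using smult[OF _ that, of "\<ominus>\<^bsub>S\<^esub> \<one>\<^bsub>S\<^esub>"] by simp
      qed
      show "v \<oplus>\<^bsub>S\<^esub> w \<in> ?V" if "v \<in> ?V" "w \<in> ?V" for v w
        using that add by auto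
    qed
    show "s \<otimes>\<^bsub>S\<^esub> v \<in> ?V" "v \<otimes>\<^bsub>S\<^esub> s \<in> ?V" if "v \<in> ?V" "s \<in> carrier S" for v s
      using smult[OF that(2,1)] S.m_comm[OF that(2) subsetD[OF sub that(1)]] by simp_all
  qed
qed

text \<open>
  A functional \<open>\<theta>\<^sub>0\<close> on \<open>\<^sup>eR\<close> with values in \<open>R / j\<^sup>-\<^sup>1(Q)\<close> gives \<open>j \<circ> \<theta>\<^sub>0\<close> with values in
  \<open>S / Q\<close>.  Multiplication by an element \<open>t\<close> of all other minimal primes makes it well defined
  modulo the nilradical of \<open>S\<close>, and the \<open>p\<^sup>k\<close>-th power makes it well defined in \<open>S\<close> itself.
\<close>

lemma exists_semilinear_value_outside:
  assumes F: "F_finite p (reduced_ring R)"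
    and c: "c \<in> ring_circ R" and Q: "minimal_prime Q S"
    and k: "\<And>x. x \<in> nilradical S \<Longrightarrow> x [^]\<^bsub>S\<^esub> (p ^ k) = \<zero>\<^bsub>S\<^esub>"
  shows "\<exists>e\<^sub>0. \<forall>e\<ge>e\<^sub>0. \<exists>\<theta>\<in>semilinear_maps e k. \<theta> c \<notin> Q"
proof -
  interpret Q: primeideal Q S using Q by (simp add: minimal_prime_def)
  define P where "P = {r \<in> carrier R. j r \<in> Q}"
  have P: "primeideal P R"
    unfolding P_def by (rule primeideal_vimage[OF j R.is_cring S.is_cring Q.primeideal])
  obtain P\<^sub>0 where P0: "minimal_prime P\<^sub>0 R" "P\<^sub>0 \<subseteq> P"
    using minimal_prime_below[OF R.is_cring R.noetherian_ring_axioms P] by blast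
  have P0p: "primeideal P\<^sub>0 R" using P0 by (simp add: minimal_prime_def)
  have cR: "c \<in> carrier R" "c \<notin> P\<^sub>0" using c P0 by (auto simp: ring_circ_def)
  have fin: "finite {Q'. minimal_prime Q' S \<and> Q' \<noteq> Q}"
    using finite_minimal_primes[OF S.is_cring S.noetherian_ring_axioms] by (rule rev_finite_subset) blast
  have ideals: "ideal Q' S" if "minimal_prime Q' S" for Q'
    by (rule primeideal.axioms(1)) (use that in \<open>simp add: minimal_prime_def\<close>)
  have not_le: "\<not> Q' \<subseteq> Q" if "minimal_prime Q' S" "Q' \<noteq> Q" for Q'
    using that Q unfolding minimal_prime_def by metis
  obtain t where t: "t \<in> carrier S" "t \<notin> Q"
      "\<And>Q'. Q' \<in> {Q'. minimal_prime Q' S \<and> Q' \<noteq> Q} \<Longrightarrow> t \<in> Q'"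
    by (rule Q.obtain_common_element_outside[OF fin]) (use ideals not_le in \<open>simp_all\<close>)
  have tQ: "(t \<otimes>\<^bsub>S\<^esub> a) [^]\<^bsub>S\<^esub> (p ^ k) = (t \<otimes>\<^bsub>S\<^esub> b) [^]\<^bsub>S\<^esub> (p ^ k)"
    if a: "a \<in> carrier S" and b: "b \<in> carrier S" and ab: "a \<ominus>\<^bsub>S\<^esub> b \<in> Q" for a b
  proof -
    have tab: "t \<otimes>\<^bsub>S\<^esub> (a \<ominus>\<^bsub>S\<^esub> b) \<in> carrier S" using t(1) a b by simp
    have "t \<otimes>\<^bsub>S\<^esub> (a \<ominus>\<^bsub>S\<^esub> b) \<in> Q'" if Q': "minimal_prime Q' S" for Q'
    proof (cases "Q' = Q")
      case True
      then show ?thesis using Q.I_l_closed[OF ab t(1)] by simp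
    next
      case False
      then have "t \<in> Q'" using t(3)[of Q'] Q' by simp
      then show ?thesis using ideal.I_r_closed[OF ideals[OF Q']] a b by simp
    qed
    then have "t \<otimes>\<^bsub>S\<^esub> (a \<ominus>\<^bsub>S\<^esub> b) \<in> nilradical S"
      by (rule minimal_primes_inter_nilradical[OF S.is_cring S.noetherian_ring_axioms tab])
    then have zero: "(t \<otimes>\<^bsub>S\<^esub> (a \<ominus>\<^bsub>S\<^esub> b)) [^]\<^bsub>S\<^esub> (p ^ k) = \<zero>\<^bsub>S\<^esub>" by (rule k)
    have "t \<otimes>\<^bsub>S\<^esub> a = t \<otimes>\<^bsub>S\<^esub> (a \<ominus>\<^bsub>S\<^esub> b) \<oplus>\<^bsub>S\<^esub> t \<otimes>\<^bsub>S\<^esub> b" using t(1) a b by algebra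
    then have "(t \<otimes>\<^bsub>S\<^esub> a) [^]\<^bsub>S\<^esub> (p ^ k)
        = (t \<otimes>\<^bsub>S\<^esub> (a \<ominus>\<^bsub>S\<^esub> b)) [^]\<^bsub>S\<^esub> (p ^ k) \<oplus>\<^bsub>S\<^esub> (t \<otimes>\<^bsub>S\<^esub> b) [^]\<^bsub>S\<^esub> (p ^ k)"
      using S.frobenius_pow_add[OF tab, of "t \<otimes>\<^bsub>S\<^esub> b" k] t(1) b by simp
    then show ?thesis using zero t(1) b by simp
  qed
  obtain e\<^sub>0 where e0: "\<And>e. e \<ge> e\<^sub>0 \<Longrightarrow> \<exists>\<theta>\<in>carrier R \<rightarrow> carrier R. \<theta> c \<notin> P \<and>
     (\<forall>x\<in>carrier R. \<forall>y\<in>carrier R. \<theta> (x \<oplus>\<^bsub>R\<^esub> y) \<ominus>\<^bsub>R\<^esub> (\<theta> x \<oplus>\<^bsub>R\<^esub> \<theta> y) \<in> P) \<and>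
     (\<forall>r\<in>carrier R. \<forall>x\<in>carrier R. \<theta> (r [^]\<^bsub>R\<^esub> (p ^ e) \<otimes>\<^bsub>R\<^esub> x) \<ominus>\<^bsub>R\<^esub> r \<otimes>\<^bsub>R\<^esub> \<theta> x \<in> P)"
    using R.exists_frob_functional[OF F P0p P P0(2) cR] by blast
  show ?thesis
  proof (intro exI[of _ e\<^sub>0] allI impI)
    fix e assume "e\<^sub>0 \<le> e"
    then obtain \<theta>0 where \<theta>0: "\<theta>0 \<in> carrier R \<rightarrow> carrier R" "\<theta>0 c \<notin> P"
      and add: "\<And>x y. x \<in> carrier R \<Longrightarrow> y \<in> carrier R \<Longrightarrow> \<theta>0 (x \<oplus>\<^bsub>R\<^esub> y) \<ominus>\<^bsub>R\<^esub> (\<theta>0 x \<oplus>\<^bsub>R\<^esub> \<theta>0 y) \<in> P"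
      and lin: "\<And>r x. r \<in> carrier R \<Longrightarrow> x \<in> carrier R \<Longrightarrow> \<theta>0 (r [^]\<^bsub>R\<^esub> (p ^ e) \<otimes>\<^bsub>R\<^esub> x) \<ominus>\<^bsub>R\<^esub> r \<otimes>\<^bsub>R\<^esub> \<theta>0 x \<in> P"
      using e0[of e] by blast
    have \<theta>0c: "\<theta>0 x \<in> carrier R" if "x \<in> carrier R" for x using \<theta>0(1) that by blast
    have jP: "j a \<ominus>\<^bsub>S\<^esub> j b \<in> Q" if "a \<in> carrier R" "b \<in> carrier R" "a \<ominus>\<^bsub>R\<^esub> b \<in> P" for a b
      using that by (simp add: P_def R.minus_eq S.minus_eq)
    define \<theta> where "\<theta> x = (t \<otimes>\<^bsub>S\<^esub> j (\<theta>0 x)) [^]\<^bsub>S\<^esub> (p ^ k)" for x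
    have "\<theta> \<in> semilinear_maps e k"
      unfolding semilinear_maps_def
    proof (intro CollectI conjI ballI)
      show "\<theta> \<in> carrier R \<rightarrow> carrier S" unfolding \<theta>_def using \<theta>0c t(1) by auto
    next
      fix x y assume x: "x \<in> carrier R" and y: "y \<in> carrier R"
      have "\<theta> (x \<oplus>\<^bsub>R\<^esub> y) = (t \<otimes>\<^bsub>S\<^esub> j (\<theta>0 x \<oplus>\<^bsub>R\<^esub> \<theta>0 y)) [^]\<^bsub>S\<^esub> (p ^ k)"
        unfolding \<theta>_def using x y \<theta>0c by (intro tQ jP add) auto
      also have "\<dots> = (t \<otimes>\<^bsub>S\<^esub> j (\<theta>0 x) \<oplus>\<^bsub>S\<^esub> t \<otimes>\<^bsub>S\<^esub> j (\<theta>0 y)) [^]\<^bsub>S\<^esub> (p ^ k)"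
        using x y \<theta>0c t(1) by (simp add: S.r_distr)
      also have "\<dots> = \<theta> x \<oplus>\<^bsub>S\<^esub> \<theta> y"
        unfolding \<theta>_def using x y \<theta>0c t(1) by (intro S.frobenius_pow_add) auto
      finally show "\<theta> (x \<oplus>\<^bsub>R\<^esub> y) = \<theta> x \<oplus>\<^bsub>S\<^esub> \<theta> y" .
    next
      fix r x assume r: "r \<in> carrier R" and x: "x \<in> carrier R"
      have "\<theta> (r [^]\<^bsub>R\<^esub> (p ^ e) \<otimes>\<^bsub>R\<^esub> x) = (t \<otimes>\<^bsub>S\<^esub> j (r \<otimes>\<^bsub>R\<^esub> \<theta>0 x)) [^]\<^bsub>S\<^esub> (p ^ k)"
        unfolding \<theta>_def using r x \<theta>0c by (intro tQ jP lin) auto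
      also have "\<dots> = (j r \<otimes>\<^bsub>S\<^esub> (t \<otimes>\<^bsub>S\<^esub> j (\<theta>0 x))) [^]\<^bsub>S\<^esub> (p ^ k)"
        using r x \<theta>0c t(1) by (simp add: S.m_lcomm)
      also have "\<dots> = j r [^]\<^bsub>S\<^esub> (p ^ k) \<otimes>\<^bsub>S\<^esub> \<theta> x"
        unfolding \<theta>_def using r x \<theta>0c t(1) by (intro S.nat_pow_distrib) auto
      finally show "\<theta> (r [^]\<^bsub>R\<^esub> (p ^ e) \<otimes>\<^bsub>R\<^esub> x) = j r [^]\<^bsub>S\<^esub> (p ^ k) \<otimes>\<^bsub>S\<^esub> \<theta> x" .
    qed
    moreover have "\<theta> c \<notin> Q"
    proof
      assume "\<theta> c \<in> Q"
      then have "t \<otimes>\<^bsub>S\<^esub> j (\<theta>0 c) \<in> Q"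
        unfolding \<theta>_def using Q.pow_in_imp_in[of "t \<otimes>\<^bsub>S\<^esub> j (\<theta>0 c)" "p ^ k"] t(1) \<theta>0c[OF cR(1)] by simp
      then have "j (\<theta>0 c) \<in> Q" using Q.I_prime[of t "j (\<theta>0 c)"] t \<theta>0c[OF cR(1)] by auto
      then show False using \<theta>0(2) \<theta>0c[OF cR(1)] by (simp add: P_def)
    qed
    ultimately show "\<exists>\<theta>\<in>semilinear_maps e k. \<theta> c \<notin> Q" by blast
  qed
qed

text \<open>
  The exponent \<open>k\<close> depends on the nilradical of \<open>S\<close> only, and every large \<open>e\<close> serves for a given
  minimal prime of \<open>S\<close>, so one \<open>e\<close> serves for all of them.  Then the ideal of values is contained
  in no minimal prime.
\<close>

lemma exists_semilinear_value_in_circ: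
  assumes F: "F_finite p (reduced_ring R)" and c: "c \<in> ring_circ R"
  shows "\<exists>e k. \<exists>\<theta>\<in>semilinear_maps e k. \<theta> c \<in> ring_circ S"
proof -
  have cR: "c \<in> carrier R" using c by (simp add: ring_circ_def)
  obtain k where k: "\<And>x n. x \<in> carrier S \<Longrightarrow> x [^]\<^bsub>S\<^esub> (n::nat) \<in> {\<zero>\<^bsub>S\<^esub>} \<Longrightarrow> x [^]\<^bsub>S\<^esub> (p ^ k) \<in> {\<zero>\<^bsub>S\<^esub>}"
    using S.frobenius_preimages_stabilise[OF S.zeroideal] by blast
  have k': "x [^]\<^bsub>S\<^esub> (p ^ k) = \<zero>\<^bsub>S\<^esub>" if "x \<in> nilradical S" for x
    using k[of x] that by (auto simp: nilradical_def)
  let ?\<Q> = "{Q. minimal_prime Q S}"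
  have fin: "finite ?\<Q>"
    by (rule finite_minimal_primes[OF S.is_cring S.noetherian_ring_axioms])
  have "\<forall>Q\<in>?\<Q>. eventually (\<lambda>e. \<exists>\<theta>\<in>semilinear_maps e k. \<theta> c \<notin> Q) sequentially"
    using exists_semilinear_value_outside[OF F c _ k'] by (auto simp: eventually_sequentially)
  then have "eventually (\<lambda>e. \<forall>Q\<in>?\<Q>. \<exists>\<theta>\<in>semilinear_maps e k. \<theta> c \<notin> Q) sequentially"
    by (rule eventually_ball_finite[OF fin])
  then obtain e where e: "\<forall>Q\<in>?\<Q>. \<exists>\<theta>\<in>semilinear_maps e k. \<theta> c \<notin> Q"
    by (auto simp: eventually_sequentially)
  let ?V = "(\<lambda>\<theta>. \<theta> c) ` semilinear_maps e k"
  have "\<exists>x\<in>?V. \<forall>Q\<in>?\<Q>. x \<notin> Q"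
  proof (rule S.prime_avoidance[OF semilinear_values_ideal[OF cR] fin])
    fix Q assume "Q \<in> ?\<Q>"
    then show "primeideal Q S" "\<not> ?V \<subseteq> Q"
      using e by (auto simp: minimal_prime_def)
  next
    fix Q Q' assume "Q \<in> ?\<Q>" "Q' \<in> ?\<Q>" "Q \<subseteq> Q'"
    then show "Q = Q'" unfolding minimal_prime_def by blast
  qed
  then obtain \<theta> where \<theta>: "\<theta> \<in> semilinear_maps e k" "\<And>Q. minimal_prime Q S \<Longrightarrow> \<theta> c \<notin> Q"
    by blast
  then have "\<theta> c \<in> ring_circ S"
    using semilinear_mapsD(1)[OF \<theta>(1) cR] by (simp add: ring_circ_def)
  then show ?thesis using \<theta>(1) by blast
qed

end

section \<open>Evaluation on tight interiors\<close>

lemma Hom_module_simps: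
  "g \<in> carrier (Hom_module R S j M) \<longleftrightarrow> g \<in> carrier S \<rightarrow>\<^sub>E carrier M \<and>
     (\<forall>x\<in>carrier S. \<forall>y\<in>carrier S. g (x \<oplus>\<^bsub>S\<^esub> y) = g x \<oplus>\<^bsub>M\<^esub> g y) \<and>
     (\<forall>r\<in>carrier R. \<forall>x\<in>carrier S. g (j r \<otimes>\<^bsub>S\<^esub> x) = r \<odot>\<^bsub>M\<^esub> g x)"
  "g \<oplus>\<^bsub>Hom_module R S j M\<^esub> h = (\<lambda>t\<in>carrier S. g t \<oplus>\<^bsub>M\<^esub> h t)"
  "\<zero>\<^bsub>Hom_module R S j M\<^esub> = (\<lambda>t\<in>carrier S. \<zero>\<^bsub>M\<^esub>)"
  "s \<odot>\<^bsub>Hom_module R S j M\<^esub> g = (\<lambda>t\<in>carrier S. g (s \<otimes>\<^bsub>S\<^esub> t))"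
  by (simp_all add: Hom_module_def module_hom_def restrict_scalars_def regular_module_def)

lemma abelian_monoid_Hom_module:
  assumes "module R M" "cring S" "j \<in> ring_hom R S"
  shows "abelian_monoid (Hom_module R S j M)"
proof -
  interpret M: module R M by fact
  interpret S: cring S by fact
  have jc: "j r \<in> carrier S" if "r \<in> carrier R" for r
    using that assms(3) by (rule ring_hom_closed[rotated])
  have app: "g t \<in> carrier M" if "g \<in> carrier S \<rightarrow>\<^sub>E carrier M" "t \<in> carrier S" for g t
    using that by blast
  show ?thesis
  proof (rule abelian_monoidI)
    show "\<zero>\<^bsub>Hom_module R S j M\<^esub> \<in> carrier (Hom_module R S j M)"
      using jc by (auto simp: Hom_module_simps)
    show "g \<oplus>\<^bsub>Hom_module R S j M\<^esub> h \<in> carrier (Hom_module R S j M)"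
      if "g \<in> carrier (Hom_module R S j M)" "h \<in> carrier (Hom_module R S j M)" for g h
      using that jc app by (auto simp: Hom_module_simps M.smult_r_distr M.M.a_ac)
  qed (auto simp: Hom_module_simps app M.M.a_ac fun_eq_iff restrict_def PiE_def extensional_def)
qed

lemma finsum_Hom_module_apply:
  assumes "module R M" "cring S" "j \<in> ring_hom R S"
    and "finite E" "y \<in> E \<rightarrow> carrier (Hom_module R S j M)" "t \<in> carrier S"
  shows "(\<Oplus>\<^bsub>Hom_module R S j M\<^esub>i\<in>E. y i) t = (\<Oplus>\<^bsub>M\<^esub>i\<in>E. y i t)"
proof -
  interpret M: module R M by fact
  interpret H: abelian_monoid "Hom_module R S j M"
    by (rule abelian_monoid_Hom_module) fact+
  have app: "g t \<in> carrier M" if "g \<in> carrier (Hom_module R S j M)" for g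
    using that assms(6) unfolding Hom_module_simps(1) by blast
  show ?thesis using assms(4,5)
  proof (induction E)
    case empty
    then show ?case using assms(6) by (simp add: Hom_module_simps)
  next
    case (insert i E)
    then have "y i \<in> carrier (Hom_module R S j M)" "y \<in> E \<rightarrow> carrier (Hom_module R S j M)" by auto
    moreover from this have "y i t \<in> carrier M" "(\<lambda>i. y i t) \<in> E \<rightarrow> carrier M"
      using app by auto
    ultimately show ?case using insert assms(6) by (simp add: Hom_module_simps(2))
  qed
qed

lemma (in prime_char_ring) module_hom_frob_iff:
  "h \<in> module_hom R (frob e) N \<longleftrightarrow> h \<in> carrier R \<rightarrow>\<^sub>E carrier N \<and>
     (\<forall>x\<in>carrier R. \<forall>y\<in>carrier R. h (x \<oplus> y) = h x \<oplus>\<^bsub>N\<^esub> h y) \<and>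
     (\<forall>r\<in>carrier R. \<forall>x\<in>carrier R. h (r [^] (p ^ e) \<otimes> x) = r \<odot>\<^bsub>N\<^esub> h x)"
  by (simp add: module_hom_def frob_simps)

text \<open>
  Composition with a semilinear map turns \<open>S\<close>-linear maps out of \<open>\<^sup>iS\<close> into \<open>R\<close>-linear maps out
  of \<open>\<^sup>e\<^sup>+\<^sup>i\<^sup>-\<^sup>kR\<close>: the \<open>k\<close> Frobenius powers that \<open>\<theta>\<close> produces are absorbed by \<open>\<^sup>iS\<close>.
\<close>

lemma (in prime_char_ring_hom) semilinear_comp_eval:
  assumes M: "module R M" and \<theta>: "\<theta> \<in> semilinear_maps e k" and ik: "k \<le> i"
    and h: "h \<in> module_hom S (S.frob i) (Hom_module R S j M)"
  shows "(\<lambda>x\<in>carrier R. h (\<theta> x) \<one>\<^bsub>S\<^esub>) \<in> module_hom R (R.frob (e + i - k)) M"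
proof -
  interpret M: module R M by fact
  note \<theta>D = semilinear_mapsD[OF \<theta>]
  have hH: "h s \<in> carrier (Hom_module R S j M)" if "s \<in> carrier S" for s
    using h that unfolding S.module_hom_frob_iff by blast
  have hH1: "h s \<one>\<^bsub>S\<^esub> \<in> carrier M" if "s \<in> carrier S" for s
    using hH[OF that] unfolding Hom_module_simps(1) by blast
  have h_add: "h (s \<oplus>\<^bsub>S\<^esub> s') = h s \<oplus>\<^bsub>Hom_module R S j M\<^esub> h s'" if "s \<in> carrier S" "s' \<in> carrier S" for s s'
    using h that unfolding S.module_hom_frob_iff by blast
  have h_smult: "h (s [^]\<^bsub>S\<^esub> (p ^ i) \<otimes>\<^bsub>S\<^esub> s') = s \<odot>\<^bsub>Hom_module R S j M\<^esub> h s'"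
    if "s \<in> carrier S" "s' \<in> carrier S" for s s'
    using h that unfolding S.module_hom_frob_iff by blast
  show ?thesis
    unfolding R.module_hom_frob_iff
  proof (intro conjI ballI)
    show "(\<lambda>x\<in>carrier R. h (\<theta> x) \<one>\<^bsub>S\<^esub>) \<in> carrier R \<rightarrow>\<^sub>E carrier M"
      using hH1[OF \<theta>D(1)] by auto
  next
    fix x y assume "x \<in> carrier R" "y \<in> carrier R"
    then show "(\<lambda>x\<in>carrier R. h (\<theta> x) \<one>\<^bsub>S\<^esub>) (x \<oplus>\<^bsub>R\<^esub> y)
        = (\<lambda>x\<in>carrier R. h (\<theta> x) \<one>\<^bsub>S\<^esub>) x \<oplus>\<^bsub>M\<^esub> (\<lambda>x\<in>carrier R. h (\<theta> x) \<one>\<^bsub>S\<^esub>) y"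
      by (simp add: \<theta>D h_add Hom_module_simps(2))
  next
    fix r x assume r: "r \<in> carrier R" and x: "x \<in> carrier R"
    have exp: "r [^]\<^bsub>R\<^esub> (p ^ (e + i - k)) = (r [^]\<^bsub>R\<^esub> (p ^ (i - k))) [^]\<^bsub>R\<^esub> (p ^ e)"
      using R.pow_p_add[OF r, of "i - k" e] ik by (simp add: add.commute)
    have "j (r [^]\<^bsub>R\<^esub> (p ^ (i - k))) [^]\<^bsub>S\<^esub> (p ^ k) = j r [^]\<^bsub>S\<^esub> (p ^ i)"
      using S.pow_p_add[of "j r" "i - k" k] ik r by simp
    then have "\<theta> (r [^]\<^bsub>R\<^esub> (p ^ (e + i - k)) \<otimes>\<^bsub>R\<^esub> x) = j r [^]\<^bsub>S\<^esub> (p ^ i) \<otimes>\<^bsub>S\<^esub> \<theta> x"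
      unfolding exp using \<theta>D(3)[of "r [^]\<^bsub>R\<^esub> (p ^ (i - k))" x] r x by simp
    then have "h (\<theta> (r [^]\<^bsub>R\<^esub> (p ^ (e + i - k)) \<otimes>\<^bsub>R\<^esub> x)) \<one>\<^bsub>S\<^esub> = h (\<theta> x) (j r \<otimes>\<^bsub>S\<^esub> \<one>\<^bsub>S\<^esub>)"
      using h_smult[of "j r" "\<theta> x"] \<theta>D(1)[OF x] r by (simp add: Hom_module_simps(4))
    also have "\<dots> = r \<odot>\<^bsub>M\<^esub> h (\<theta> x) \<one>\<^bsub>S\<^esub>"
      using hH[OF \<theta>D(1)[OF x]] r unfolding Hom_module_simps(1) by blast
    finally show "(\<lambda>x\<in>carrier R. h (\<theta> x) \<one>\<^bsub>S\<^esub>) (r [^]\<^bsub>R\<^esub> (p ^ (e + i - k)) \<otimes>\<^bsub>R\<^esub> x)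
        = r \<odot>\<^bsub>M\<^esub> (\<lambda>x\<in>carrier R. h (\<theta> x) \<one>\<^bsub>S\<^esub>) x"
      using r x by simp
  qed
qed

theorem theorem3p4:
  fixes R :: "('a, 'r) ring_scheme" and S :: "('b, 's) ring_scheme"
    and M :: "('a, 'm, 'k) module_scheme" and j :: "'a \<Rightarrow> 'b" and p :: nat
  assumes "prime p"
    and "cring R" and "noetherian_ring R" and "has_char R p"
    and "cring S" and "noetherian_ring S" and "has_char S p"
    and "F_finite p (reduced_ring R)" and "F_finite p (reduced_ring S)"
    and "j \<in> ring_hom R S"
    and "module R M"
  shows "(\<lambda>g. g \<one>\<^bsub>S\<^esub>) ` tight_interior p S (Hom_module R S j M) \<subseteq> tight_interior p R M"
proof -
  interpret prime_char_ring_hom R S p j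
    using assms
    by (intro prime_char_ring_hom.intro noetherian_prime_char_ring.intro prime_char_ring.intro
        prime_char_ring_axioms.intro prime_char_ring_hom_axioms.intro)
  interpret M: module R M by fact
  have "g \<one>\<^bsub>S\<^esub> \<in> interior_approx p R M c e\<^sub>0"
    if g: "g \<in> tight_interior p S (Hom_module R S j M)" and c: "c \<in> ring_circ R" for g c e\<^sub>0
  proof -
    have cR: "c \<in> carrier R" using c by (simp add: ring_circ_def)
    obtain e k \<theta> where \<theta>: "\<theta> \<in> semilinear_maps e k" "\<theta> c \<in> ring_circ S"
      using exists_semilinear_value_in_circ[OF assms(8) c] by blast
    note \<theta>c = semilinear_mapsD(1)[OF \<theta>(1) cR]
    have "g \<in> interior_approx p S (Hom_module R S j M) (\<theta> c) (e\<^sub>0 + k)"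
      using g \<theta>(2) unfolding tight_interior_def by blast
    then obtain E y where E: "finite E" "E \<subseteq> {e\<^sub>0 + k..}"
      and y: "\<forall>i\<in>E. y i \<in> (\<lambda>h. h (\<theta> c)) ` module_hom S (S.frob i) (Hom_module R S j M)"
      and gE: "g = (\<Oplus>\<^bsub>Hom_module R S j M\<^esub>i\<in>E. y i)"
      unfolding interior_approx_def submodule_sum_def by blast
    have "\<forall>i\<in>E. \<exists>h. h \<in> module_hom S (S.frob i) (Hom_module R S j M) \<and> y i = h (\<theta> c)"
      using y by blast
    then obtain h where h: "\<And>i. i \<in> E \<Longrightarrow> h i \<in> module_hom S (S.frob i) (Hom_module R S j M)"
        "\<And>i. i \<in> E \<Longrightarrow> y i = h i (\<theta> c)"
      by (auto dest!: bchoice)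
    \<comment> \<open>Distinct \<open>i \<ge> k\<close> go to distinct exponents, so the sum may be reindexed; \<open>i \<ge> e\<^sub>0 + k\<close>
      ensures that the new exponents are at least \<open>e\<^sub>0\<close>.\<close>
    define \<sigma> where "\<sigma> i = e + i - k" for i
    define \<phi> where "\<phi> i = (\<lambda>x\<in>carrier R. h i (\<theta> x) \<one>\<^bsub>S\<^esub>)" for i
    have ik: "e\<^sub>0 + k \<le> i" if "i \<in> E" for i using E(2) that by auto
    have inj: "inj_on \<sigma> E"
    proof (rule inj_onI)
      fix i i' assume "i \<in> E" "i' \<in> E" "\<sigma> i = \<sigma> i'"
      then show "i = i'" using ik[of i] ik[of i'] by (simp add: \<sigma>_def)
    qed
    have \<phi>: "\<phi> i \<in> module_hom R (R.frob (\<sigma> i)) M" if "i \<in> E" for i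
      unfolding \<phi>_def \<sigma>_def
      by (rule semilinear_comp_eval[OF assms(11) \<theta>(1) _ h(1)[OF that]]) (use ik[OF that] in simp)
    have \<phi>c: "\<phi> i c \<in> carrier M" if "i \<in> E" for i
      using \<phi>[OF that] cR unfolding R.module_hom_frob_iff by blast
    define z where "z n = \<phi> (the_inv_into E \<sigma> n) c" for n
    have z: "z (\<sigma> i) = \<phi> i c" if "i \<in> E" for i
      unfolding z_def using the_inv_into_f_f[OF inj that] by simp
    have "h i (\<theta> c) \<in> carrier (Hom_module R S j M)" if "i \<in> E" for i
      using h(1)[OF that] \<theta>c unfolding S.module_hom_frob_iff by blast
    then have "y \<in> E \<rightarrow> carrier (Hom_module R S j M)"
      using h(2) by simp
    then have "g \<one>\<^bsub>S\<^esub> = (\<Oplus>\<^bsub>M\<^esub>i\<in>E. y i \<one>\<^bsub>S\<^esub>)"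
      unfolding gE using finsum_Hom_module_apply[OF assms(11,5,10) E(1) _ S.one_closed] by blast
    also have "\<dots> = (\<Oplus>\<^bsub>M\<^esub>i\<in>E. z (\<sigma> i))"
      by (rule M.M.finsum_cong') (use z h(2) cR \<phi>c in \<open>auto simp: \<phi>_def\<close>)
    also have "\<dots> = (\<Oplus>\<^bsub>M\<^esub>n\<in>\<sigma> ` E. z n)"
      by (rule M.M.add.finprod_reindex[symmetric]) (use inj z \<phi>c in auto)
    finally have "g \<one>\<^bsub>S\<^esub> = (\<Oplus>\<^bsub>M\<^esub>n\<in>\<sigma> ` E. z n)" .
    moreover have "e\<^sub>0 \<le> \<sigma> i" if "i \<in> E" for i
      using ik[OF that] by (simp add: \<sigma>_def)
    then have "\<sigma> ` E \<subseteq> {e\<^sub>0..}" by auto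
    moreover have "\<forall>n\<in>\<sigma> ` E. z n \<in> (\<lambda>f. f c) ` module_hom R (R.frob n) M"
      using z \<phi> by auto
    ultimately show ?thesis
      unfolding interior_approx_def submodule_sum_def using E(1) by blast
  qed
  then show ?thesis unfolding tight_interior_def by blast
qed

end
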